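(* Let $H$ be a separable infinite-dimensional complex Hilbert space, $\ell^2=\ell^2(\mathbb{Z}_+)$, and $\mathcal{H}=\ell^2(\mathbb{Z}_+,H)=(\bigoplus_{n\in\mathbb{Z}_+}H)_{\ell^2}$. Let $B$ be the backward shift on $\ell^2$, $B(x_0,x_1,\dots)=(x_1,x_2,\dots)$, and $B_\infty$ the backward shift on $\mathcal{H}$, $B_\infty(x_0,x_1,\dots)=(x_1,x_2,\dots)$ with $x_n\in H$; $B^*$ and $B_\infty^*$ are their adjoints (the forward shifts). Then: (i) $L_B$ and $R_{B^*}$ are universal operators on $\mathcal{C}_2(\ell^2)$, and $L_{B_\infty}$ and $R_{B_\infty^*}$ are universal operators on $\mathcal{C}_2(\mathcal{H})$; (ii) $(L_B,R_{B^*})$ is not a universal commuting pair on $\mathcal{C}_2(\ell^2)$; (iii) $(L_{B_\infty},R_{B_\infty^*})$ is a universal commuting pair on $\mathcal{C}_2(\mathcal{H})$.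
   Context: For a separable Hilbert space $K$, $\mathcal{C}_2(K)$ is the Hilbert space of Hilbert–Schmidt operators on $K$ with the Hilbert–Schmidt norm $\|T\|_2=(\sum_n\|Tf_n\|^2)^{1/2}$ for an orthonormal basis $(f_n)$. For $U\in\mathcal{L}(K)$, $L_U(S)=US$ and $R_U(S)=SU$ for $S\in\mathcal{C}_2(K)$; these are bounded operators on $\mathcal{C}_2(K)$ and $L_U$, $R_V$ commute. An operator $U$ on a separable infinite-dimensional Hilbert space $E$ is universal if for every $T\in\mathcal{L}(E)$ there exist a closed $U$-invariant subspace $M\subset E$ and $c\neq0$ such that $U|_M$ is similar to $cT$ (i.e. $U|_M=J^{-1}(cT)J$ for some linear isomorphism $J:M\to E$). A commuting pair $(U_1,U_2)\in\mathcal{L}(E)^2$ is a universal commuting pair if for every commuting pair $(S_1,S_2)\in\mathcal{L}(E)^2$ there exist $c\neq0$, a closed subspace $M\subset E$ invariant under both $U_1,U_2$, and a linear isomorphism $V:E\to M$ with $U_1V=cVS_1$ and $U_2V=cVS_2$. *)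

theory Defs
  imports "HOL-Analysis.Analysis" "HOL-Library.Function_Algebras"
begin

class complex_vector = ab_group_add +
  fixes scaleC :: "complex \<Rightarrow> 'a \<Rightarrow> 'a" (infixr \<open>*\<^sub>C\<close> 75)
  assumes scaleC_add_right: "a *\<^sub>C (x + y) = a *\<^sub>C x + a *\<^sub>C y"
    and scaleC_add_left: "(a + b) *\<^sub>C x = a *\<^sub>C x + b *\<^sub>C x"
    and scaleC_scaleC: "a *\<^sub>C (b *\<^sub>C x) = (a * b) *\<^sub>C x"
    and scaleC_one: "1 *\<^sub>C x = x"

instantiation complex :: complex_vector
begin
definition scaleC_complex_def: "a *\<^sub>C (x::complex) = a * x"
instance by standard (auto simp: scaleC_complex_def algebra_simps)
end

instantiation "fun" :: (type, complex_vector) complex_vector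
begin
definition scaleC_fun_def: "a *\<^sub>C (f::'a \<Rightarrow> 'b) = (\<lambda>x. a *\<^sub>C f x)"
instance by standard
  (auto simp: scaleC_fun_def scaleC_add_right scaleC_add_left scaleC_scaleC scaleC_one
     fun_eq_iff)
end

text \<open>A (complex) space is a carrier set V inside an ambient complex vector type,
  together with an inner product ip (linear in the first argument).\<close>

definition csubspace :: "'v::complex_vector set \<Rightarrow> bool" where
  "csubspace V \<longleftrightarrow> 0 \<in> V \<and> (\<forall>x\<in>V. \<forall>y\<in>V. x + y \<in> V) \<and> (\<forall>c. \<forall>x\<in>V. c *\<^sub>C x \<in> V)"

definition cnorm :: "('v \<Rightarrow> 'v \<Rightarrow> complex) \<Rightarrow> 'v \<Rightarrow> real" where
  "cnorm ip x = sqrt (Re (ip x x))"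

definition inner_product_space :: "'v::complex_vector set \<Rightarrow> ('v \<Rightarrow> 'v \<Rightarrow> complex) \<Rightarrow> bool" where
  "inner_product_space V ip \<longleftrightarrow> csubspace V \<and>
     (\<forall>x\<in>V. \<forall>y\<in>V. \<forall>z\<in>V. ip (x + y) z = ip x z + ip y z) \<and>
     (\<forall>c. \<forall>x\<in>V. \<forall>y\<in>V. ip (c *\<^sub>C x) y = c * ip x y) \<and>
     (\<forall>x\<in>V. \<forall>y\<in>V. ip y x = cnj (ip x y)) \<and>
     (\<forall>x\<in>V. Re (ip x x) \<ge> 0) \<and>
     (\<forall>x\<in>V. ip x x = 0 \<longrightarrow> x = 0)"

definition complete_on :: "'v::complex_vector set \<Rightarrow> ('v \<Rightarrow> 'v \<Rightarrow> complex) \<Rightarrow> bool" where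
  "complete_on V ip \<longleftrightarrow> (\<forall>s::nat \<Rightarrow> 'v. range s \<subseteq> V \<longrightarrow>
     (\<forall>e>0. \<exists>N. \<forall>m\<ge>N. \<forall>n\<ge>N. cnorm ip (s m - s n) < e) \<longrightarrow>
     (\<exists>l\<in>V. (\<lambda>n. cnorm ip (s n - l)) \<longlonglongrightarrow> 0))"

definition hilbert_space :: "'v::complex_vector set \<Rightarrow> ('v \<Rightarrow> 'v \<Rightarrow> complex) \<Rightarrow> bool" where
  "hilbert_space V ip \<longleftrightarrow> inner_product_space V ip \<and> complete_on V ip"

definition separable_on :: "'v::complex_vector set \<Rightarrow> ('v \<Rightarrow> 'v \<Rightarrow> complex) \<Rightarrow> bool" where
  "separable_on V ip \<longleftrightarrow> (\<exists>D. countable D \<and> D \<subseteq> V \<and>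
     (\<forall>x\<in>V. \<forall>e>0. \<exists>d\<in>D. cnorm ip (x - d) < e))"

definition cspan :: "'v::complex_vector set \<Rightarrow> 'v set" where
  "cspan F = {v. \<exists>c. v = (\<Sum>x\<in>F. c x *\<^sub>C x)}"

definition infinite_dim :: "'v::complex_vector set \<Rightarrow> bool" where
  "infinite_dim V \<longleftrightarrow> \<not> (\<exists>F. finite F \<and> F \<subseteq> V \<and> V \<subseteq> cspan F)"

definition clinear_on :: "'v::complex_vector set \<Rightarrow> ('v \<Rightarrow> 'w::complex_vector) \<Rightarrow> bool" where
  "clinear_on V T \<longleftrightarrow> (\<forall>x\<in>V. \<forall>y\<in>V. T (x + y) = T x + T y) \<and>
     (\<forall>c. \<forall>x\<in>V. T (c *\<^sub>C x) = c *\<^sub>C T x)"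

definition bounded_op :: "'v::complex_vector set \<Rightarrow> ('v \<Rightarrow> 'v \<Rightarrow> complex) \<Rightarrow> ('v \<Rightarrow> 'v) \<Rightarrow> bool" where
  "bounded_op V ip T \<longleftrightarrow> (\<forall>x\<in>V. T x \<in> V) \<and> clinear_on V T \<and>
     (\<exists>K. \<forall>x\<in>V. cnorm ip (T x) \<le> K * cnorm ip x)"

definition closed_subspace :: "'v::complex_vector set \<Rightarrow> ('v \<Rightarrow> 'v \<Rightarrow> complex) \<Rightarrow> 'v set \<Rightarrow> bool" where
  "closed_subspace V ip M \<longleftrightarrow> M \<subseteq> V \<and> csubspace M \<and>
     (\<forall>s::nat \<Rightarrow> 'v. \<forall>l\<in>V. range s \<subseteq> M \<longrightarrow> (\<lambda>n. cnorm ip (s n - l)) \<longlonglongrightarrow> 0 \<longrightarrow> l \<in> M)"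

definition lin_iso :: "('v::complex_vector \<Rightarrow> 'v \<Rightarrow> complex) \<Rightarrow> 'v set \<Rightarrow> 'v set \<Rightarrow> ('v \<Rightarrow> 'v) \<Rightarrow> bool" where
  "lin_iso ip A B J \<longleftrightarrow> clinear_on A J \<and> bij_betw J A B \<and>
     (\<exists>K. \<forall>x\<in>A. cnorm ip (J x) \<le> K * cnorm ip x) \<and>
     (\<exists>K. \<forall>x\<in>A. cnorm ip x \<le> K * cnorm ip (J x))"

definition universal_op :: "'v::complex_vector set \<Rightarrow> ('v \<Rightarrow> 'v \<Rightarrow> complex) \<Rightarrow> ('v \<Rightarrow> 'v) \<Rightarrow> bool" where
  "universal_op E ip U \<longleftrightarrow> bounded_op E ip U \<and>
     (\<forall>T. bounded_op E ip T \<longrightarrow>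
        (\<exists>M c J. closed_subspace E ip M \<and> (\<forall>x\<in>M. U x \<in> M) \<and> c \<noteq> 0 \<and>
           lin_iso ip M E J \<and> (\<forall>x\<in>M. J (U x) = c *\<^sub>C T (J x))))"

definition commuting_pair :: "'v::complex_vector set \<Rightarrow> ('v \<Rightarrow> 'v \<Rightarrow> complex) \<Rightarrow> ('v \<Rightarrow> 'v) \<Rightarrow> ('v \<Rightarrow> 'v) \<Rightarrow> bool" where
  "commuting_pair E ip S1 S2 \<longleftrightarrow> bounded_op E ip S1 \<and> bounded_op E ip S2 \<and>
     (\<forall>x\<in>E. S1 (S2 x) = S2 (S1 x))"

definition universal_commuting_pair :: "'v::complex_vector set \<Rightarrow> ('v \<Rightarrow> 'v \<Rightarrow> complex) \<Rightarrow> ('v \<Rightarrow> 'v) \<Rightarrow> ('v \<Rightarrow> 'v) \<Rightarrow> bool" where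
  "universal_commuting_pair E ip U1 U2 \<longleftrightarrow> commuting_pair E ip U1 U2 \<and>
     (\<forall>S1 S2. commuting_pair E ip S1 S2 \<longrightarrow>
        (\<exists>c M V. c \<noteq> 0 \<and> closed_subspace E ip M \<and>
           (\<forall>x\<in>M. U1 x \<in> M) \<and> (\<forall>x\<in>M. U2 x \<in> M) \<and>
           lin_iso ip E M V \<and>
           (\<forall>x\<in>E. U1 (V x) = c *\<^sub>C V (S1 x)) \<and>
           (\<forall>x\<in>E. U2 (V x) = c *\<^sub>C V (S2 x))))"

definition onb :: "'v::complex_vector set \<Rightarrow> ('v \<Rightarrow> 'v \<Rightarrow> complex) \<Rightarrow> 'v set \<Rightarrow> bool" where
  "onb V ip B \<longleftrightarrow> B \<subseteq> V \<and> (\<forall>e\<in>B. \<forall>f\<in>B. ip e f = (if e = f then 1 else 0)) \<and>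
     (\<forall>x\<in>V. (\<forall>e\<in>B. ip x e = 0) \<longrightarrow> x = 0)"

definition some_onb :: "'v::complex_vector set \<Rightarrow> ('v \<Rightarrow> 'v \<Rightarrow> complex) \<Rightarrow> 'v set" where
  "some_onb V ip = (SOME B. onb V ip B)"

text \<open>C_2(K): bounded operators on K with finite Hilbert--Schmidt norm, represented as
  functions that vanish outside the carrier (so that equality of operators is equality
  of functions).\<close>
definition HS :: "'v::complex_vector set \<Rightarrow> ('v \<Rightarrow> 'v \<Rightarrow> complex) \<Rightarrow> ('v \<Rightarrow> 'v) set" where
  "HS K ip = {T. bounded_op K ip T \<and> (\<forall>x. x \<notin> K \<longrightarrow> T x = 0) \<and>
                 (\<lambda>e. (cnorm ip (T e))\<^sup>2) summable_on some_onb K ip}"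

definition HS_ip :: "'v::complex_vector set \<Rightarrow> ('v \<Rightarrow> 'v \<Rightarrow> complex) \<Rightarrow> ('v \<Rightarrow> 'v) \<Rightarrow> ('v \<Rightarrow> 'v) \<Rightarrow> complex" where
  "HS_ip K ip S T = (\<Sum>\<^sub>\<infinity>e\<in>some_onb K ip. ip (S e) (T e))"

definition Lmult :: "'v set \<Rightarrow> ('v \<Rightarrow> 'v::zero) \<Rightarrow> ('v \<Rightarrow> 'v) \<Rightarrow> ('v \<Rightarrow> 'v)" where
  "Lmult K U S = (\<lambda>x. if x \<in> K then U (S x) else 0)"

definition Rmult :: "'v set \<Rightarrow> ('v \<Rightarrow> 'v::zero) \<Rightarrow> ('v \<Rightarrow> 'v) \<Rightarrow> ('v \<Rightarrow> 'v)" where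
  "Rmult K U S = (\<lambda>x. if x \<in> K then S (U x) else 0)"

definition ell2 :: "'h::complex_vector set \<Rightarrow> ('h \<Rightarrow> 'h \<Rightarrow> complex) \<Rightarrow> (nat \<Rightarrow> 'h) set" where
  "ell2 Hs ipH = {x. (\<forall>n. x n \<in> Hs) \<and> summable (\<lambda>n. (cnorm ipH (x n))\<^sup>2)}"

definition ell2_ip :: "('h \<Rightarrow> 'h \<Rightarrow> complex) \<Rightarrow> (nat \<Rightarrow> 'h) \<Rightarrow> (nat \<Rightarrow> 'h) \<Rightarrow> complex" where
  "ell2_ip ipH x y = (\<Sum>n. ipH (x n) (y n))"

definition ip_C :: "complex \<Rightarrow> complex \<Rightarrow> complex" where
  "ip_C a b = a * cnj b"

definition l2 :: "(nat \<Rightarrow> complex) set" where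
  "l2 = ell2 UNIV ip_C"

definition l2_ip :: "(nat \<Rightarrow> complex) \<Rightarrow> (nat \<Rightarrow> complex) \<Rightarrow> complex" where
  "l2_ip = ell2_ip ip_C"

text \<open>Backward shift and forward shift (its adjoint).\<close>
definition bshift :: "(nat \<Rightarrow> 'a) \<Rightarrow> (nat \<Rightarrow> 'a)" where
  "bshift x = (\<lambda>n. x (Suc n))"

definition fshift :: "(nat \<Rightarrow> 'a::zero) \<Rightarrow> (nat \<Rightarrow> 'a)" where
  "fshift x = (\<lambda>n. case n of 0 \<Rightarrow> 0 | Suc m \<Rightarrow> x m)"

end

theory Submission
  imports Defs
begin

text \<open>
  In orthonormal coordinates indexed by a set \<open>J\<close>, Hilbert--Schmidt operators are the square-summable
  \<open>J \<times> J\<close> matrices. For \<open>\<ell>\<^sup>2(\<int>\<^sub>+, H)\<close> the index set is \<open>\<nat> \<times> I\<close> with \<open>I\<close> an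
  orthonormal basis of \<open>H\<close>; left multiplication by the backward shift moves the row index, and right
  multiplication by the forward shift moves the column index.

  If \<open>S\<close> (or \<open>S\<^sub>1, S\<^sub>2\<close>, commuting) has norm at most \<open>1/2\<close>, then \<open>x \<mapsto> (S\<^sup>n x)\<^sub>n\<close> (or
  \<open>x \<mapsto> (S\<^sub>1\<^sup>n S\<^sub>2\<^sup>m x)\<^sub>n\<^sub>,\<^sub>m\<close>) embeds the space of matrices into sequences of matrices and intertwines
  \<open>S\<close> with the shifts. Such sequences can be stored in a single matrix: for one shift the other index
  provides enough room, and for two shifts one needs an injection of the matrix entries into
  \<open>I \<times> I\<close>, available when \<open>I\<close> is infinite. When \<open>I\<close> is a singleton, the joint kernel of both shifts is
  one-dimensional, so the zero pair cannot be modelled.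
\<close>

section \<open>Complex inner product spaces and coordinates\<close>

text \<open>\<open>HS\<close> and \<open>HS_ip\<close> are defined through the basis
  \<open>some_onb\<close>, about which only \<open>onb\<close> is known. So Parseval for an
  arbitrary \<open>onb\<close> and the basis independence of the Hilbert--Schmidt norm come before
  any computation with matrices. After that, the argument is about index sets. A shift reads
  coordinates along an injective map \<open>\<tau>\<close>. An embedding places copies of the index
  set by an injective \<open>\<psi>\<close>, copy \<open>g\<close> carrying one iterate. The
  intertwining relation amounts to two conditions: \<open>\<tau>\<close> sends copy \<open>g\<close>
  to the next copy, and no position outside the copies is sent into them. Since the copy holding
  \<open>x\<close> itself can be read back by a bounded map, the range is closed and the embedding
  is an isomorphism onto it. The bound 1/2 makes the iterates summable by a geometric series; the
  scalar \<open>c\<close> in the definition of universality absorbs the rescaling.\<close>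

lemma scaleC_zero_right [simp]: "c *\<^sub>C (0::'v::complex_vector) = 0"
  using scaleC_add_right[of c 0 0] by simp

lemma scaleC_zero_left [simp]: "0 *\<^sub>C (x::'v::complex_vector) = 0"
  using scaleC_add_left[of 0 0 x] by simp

lemma scaleC_uminus_one: "(-1) *\<^sub>C (x::'v::complex_vector) = - x"
proof -
  have "x + (-1) *\<^sub>C x = (1 + (-1)) *\<^sub>C x"
    unfolding scaleC_add_left scaleC_one by simp
  then show ?thesis by (simp add: eq_neg_iff_add_eq_0 add.commute)
qed

lemma csubspace_zero: "csubspace V \<Longrightarrow> 0 \<in> V"
  and csubspace_add: "csubspace V \<Longrightarrow> x \<in> V \<Longrightarrow> y \<in> V \<Longrightarrow> x + y \<in> V"
  and csubspace_scale: "csubspace V \<Longrightarrow> x \<in> V \<Longrightarrow> c *\<^sub>C x \<in> V"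
  unfolding csubspace_def by auto

lemma csubspace_diff: "csubspace V \<Longrightarrow> x \<in> V \<Longrightarrow> y \<in> V \<Longrightarrow> x - y \<in> V"
  using csubspace_add[of V x "(-1) *\<^sub>C y"] csubspace_scale[of V y "-1"]
  by (simp add: scaleC_uminus_one)

lemma csubspace_sum: "csubspace V \<Longrightarrow> (\<And>i. i \<in> F \<Longrightarrow> f i \<in> V) \<Longrightarrow> (\<Sum>i\<in>F. f i) \<in> V"
  by (induction F rule: infinite_finite_induct) (auto intro: csubspace_zero csubspace_add)

lemma clinear_on_add: "clinear_on V T \<Longrightarrow> x \<in> V \<Longrightarrow> y \<in> V \<Longrightarrow> T (x + y) = T x + T y"
  and clinear_on_scale: "clinear_on V T \<Longrightarrow> x \<in> V \<Longrightarrow> T (c *\<^sub>C x) = c *\<^sub>C T x"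
  unfolding clinear_on_def by auto

lemma clinear_on_zero: "clinear_on V T \<Longrightarrow> csubspace V \<Longrightarrow> T 0 = 0"
  using clinear_on_scale[of V T 0 0] by (simp add: csubspace_zero)

lemma clinear_on_diff:
  assumes "clinear_on V T" "csubspace V" "x \<in> V" "y \<in> V" shows "T (x - y) = T x - T y"
  using clinear_on_add[of V T x "(-1) *\<^sub>C y"] clinear_on_scale[of V T y "-1"]
    csubspace_scale[of V y "-1"] assms
  by (simp add: scaleC_uminus_one)

lemma clinear_on_sum:
  assumes "clinear_on V T" "csubspace V" "\<And>i. i \<in> F \<Longrightarrow> f i \<in> V"
  shows "T (\<Sum>i\<in>F. f i) = (\<Sum>i\<in>F. T (f i))"
  using assms(3)
proof (induction F rule: infinite_finite_induct)
  case (insert x F)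
  have "sum f F \<in> V" by (rule csubspace_sum[OF assms(2)]) (use insert in auto)
  then show ?case using clinear_on_add[OF assms(1), of "f x" "sum f F"] insert by auto
qed (auto simp: clinear_on_zero[OF assms(1,2)])

lemma sum_fun_apply: "(\<Sum>i\<in>F. f i) x = (\<Sum>i\<in>F. (f i x :: 'b::comm_monoid_add))"
  by (induction F rule: infinite_finite_induct) auto

lemma inner_product_space_csubspace: "inner_product_space V ip \<Longrightarrow> csubspace V"
  unfolding inner_product_space_def by (elim conjE)

lemma ip_add_left:
  "inner_product_space V ip \<Longrightarrow> x \<in> V \<Longrightarrow> y \<in> V \<Longrightarrow> z \<in> V \<Longrightarrow> ip (x + y) z = ip x z + ip y z"
  unfolding inner_product_space_def by (elim conjE) blast

lemma ip_scale_left: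
  "inner_product_space V ip \<Longrightarrow> x \<in> V \<Longrightarrow> y \<in> V \<Longrightarrow> ip (c *\<^sub>C x) y = c * ip x y"
  unfolding inner_product_space_def by (elim conjE) blast

lemma ip_commute: "inner_product_space V ip \<Longrightarrow> x \<in> V \<Longrightarrow> y \<in> V \<Longrightarrow> ip y x = cnj (ip x y)"
  unfolding inner_product_space_def by (elim conjE) (drule bspec, assumption, erule (1) bspec)

lemma ip_ge_zero: "inner_product_space V ip \<Longrightarrow> x \<in> V \<Longrightarrow> Re (ip x x) \<ge> 0"
  unfolding inner_product_space_def by (elim conjE) (erule bspec)

lemma ip_definite: "inner_product_space V ip \<Longrightarrow> x \<in> V \<Longrightarrow> ip x x = 0 \<Longrightarrow> x = 0"
  unfolding inner_product_space_def by (elim conjE) blast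

context
  fixes V :: "'v::complex_vector set" and ip :: "'v \<Rightarrow> 'v \<Rightarrow> complex"
  assumes V: "inner_product_space V ip"
begin

lemma ip_clinear_left: "y \<in> V \<Longrightarrow> clinear_on V (\<lambda>x. ip x y)"
  unfolding clinear_on_def by (simp add: ip_add_left[OF V] ip_scale_left[OF V] scaleC_complex_def)

lemma ip_diff_left: "x \<in> V \<Longrightarrow> y \<in> V \<Longrightarrow> z \<in> V \<Longrightarrow> ip (x - y) z = ip x z - ip y z"
  using clinear_on_diff[OF ip_clinear_left inner_product_space_csubspace[OF V]] by blast

lemma ip_diff_right: "x \<in> V \<Longrightarrow> y \<in> V \<Longrightarrow> z \<in> V \<Longrightarrow> ip z (x - y) = ip z x - ip z y"
  using ip_diff_left[of x y z] ip_commute[OF V] csubspace_diff[OF inner_product_space_csubspace[OF V]]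
  by (metis complex_cnj_diff)

lemma ip_scale_right: "x \<in> V \<Longrightarrow> y \<in> V \<Longrightarrow> ip x (c *\<^sub>C y) = cnj c * ip x y"
  using ip_scale_left[OF V, of y x c] ip_commute[OF V]
    csubspace_scale[OF inner_product_space_csubspace[OF V]]
  by (metis complex_cnj_mult)

lemma ip_zero_left: "y \<in> V \<Longrightarrow> ip 0 y = 0"
  using clinear_on_zero[OF ip_clinear_left inner_product_space_csubspace[OF V]] by blast

lemma ip_sum_left:
  "(\<And>i. i \<in> F \<Longrightarrow> f i \<in> V) \<Longrightarrow> y \<in> V \<Longrightarrow> ip (\<Sum>i\<in>F. f i) y = (\<Sum>i\<in>F. ip (f i) y)"
  using clinear_on_sum[OF ip_clinear_left inner_product_space_csubspace[OF V]] by blast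

lemma ip_self: "x \<in> V \<Longrightarrow> ip x x = of_real ((cnorm ip x)\<^sup>2)"
proof -
  assume x: "x \<in> V"
  have "Im (ip x x) = 0" using ip_commute[OF V x x] by (simp add: complex_eq_iff)
  then show ?thesis using ip_ge_zero[OF V x] by (simp add: cnorm_def complex_eq_iff)
qed

lemma cnorm_ge_zero: "x \<in> V \<Longrightarrow> cnorm ip x \<ge> 0"
  using ip_ge_zero[OF V] by (simp add: cnorm_def)

lemma cnorm_eq_zero: "x \<in> V \<Longrightarrow> cnorm ip x = 0 \<Longrightarrow> x = 0"
  using ip_self ip_definite[OF V] by simp

lemma cnorm_scale: "x \<in> V \<Longrightarrow> cnorm ip (c *\<^sub>C x) = cmod c * cnorm ip x"
proof -
  assume x: "x \<in> V"
  have "ip (c *\<^sub>C x) (c *\<^sub>C x) = (c * cnj c) * ip x x"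
    using x ip_scale_left[OF V] ip_scale_right csubspace_scale[OF inner_product_space_csubspace[OF V] x, of c]
    by simp
  also have "\<dots> = of_real ((cmod c)\<^sup>2 * (cnorm ip x)\<^sup>2)"
    using ip_self[OF x] complex_norm_square[of c] by simp
  finally have "Re (ip (c *\<^sub>C x) (c *\<^sub>C x)) = (cmod c * cnorm ip x)\<^sup>2"
    by (simp add: power_mult_distrib)
  then show ?thesis using cnorm_ge_zero[OF x] by (simp add: cnorm_def)
qed

lemma cnorm_diff_square:
  assumes "x \<in> V" "y \<in> V"
  shows "(cnorm ip (x - y))\<^sup>2 = (cnorm ip x)\<^sup>2 - 2 * Re (ip x y) + (cnorm ip y)\<^sup>2"
proof -
  have d: "x - y \<in> V" using csubspace_diff[OF inner_product_space_csubspace[OF V]] assms by blast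
  have "complex_of_real ((cnorm ip (x - y))\<^sup>2) = ip (x - y) (x - y)" using ip_self[OF d] by simp
  also have "\<dots> = ip x x - ip y x - (ip x y - ip y y)"
    using ip_diff_left ip_diff_right assms d by simp
  also have "Re \<dots> = (cnorm ip x)\<^sup>2 - 2 * Re (ip x y) + (cnorm ip y)\<^sup>2"
    using ip_self assms ip_commute[OF V, of x y] by simp
  finally show ?thesis by simp
qed

lemma ip_Cauchy_Schwarz:
  assumes x: "x \<in> V" and y: "y \<in> V" shows "cmod (ip x y) \<le> cnorm ip x * cnorm ip y"
proof (cases "cnorm ip y = 0")
  case True
  then have "y = 0" using cnorm_eq_zero y by blast
  then have "ip x y = 0" using ip_zero_left[OF x] ip_commute[OF V] x y by (metis complex_cnj_zero)
  then show ?thesis using True by simp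
next
  case False
  let ?n = "(cnorm ip y)\<^sup>2"
  \<comment> \<open>\<open>c *\<^sub>C y\<close> is the orthogonal projection of \<open>x\<close>
    onto the line of \<open>y\<close>; the inequality is the nonnegativity of the squared distance
    to it.\<close>
  define c where "c = ip x y / of_real ?n"
  have n: "?n > 0" using False by simp
  have cy: "c *\<^sub>C y \<in> V" using csubspace_scale[OF inner_product_space_csubspace[OF V] y] .
  have c2: "(cmod c)\<^sup>2 * ?n = (cmod (ip x y))\<^sup>2 / ?n"
    using n unfolding c_def norm_divide norm_of_real power_divide
    by (simp add: power2_eq_square field_simps)
  have "cnj c * ip x y = of_real ((cmod (ip x y))\<^sup>2 / ?n)"
    using complex_norm_square[of "ip x y"] by (simp add: c_def mult.commute)
  then have r: "Re (cnj c * ip x y) = (cmod (ip x y))\<^sup>2 / ?n"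
    by (metis Re_complex_of_real)
  have "0 \<le> (cnorm ip (x - c *\<^sub>C y))\<^sup>2" by simp
  also have "\<dots> = (cnorm ip x)\<^sup>2 - 2 * Re (cnj c * ip x y) + (cmod c)\<^sup>2 * ?n"
    using cnorm_diff_square[OF x cy] ip_scale_right[OF x y] cnorm_scale[OF y]
    by (simp add: power_mult_distrib)
  also have "\<dots> = (cnorm ip x)\<^sup>2 - (cmod (ip x y))\<^sup>2 / ?n" using c2 r by simp
  finally have "(cmod (ip x y))\<^sup>2 \<le> (cnorm ip x * cnorm ip y)\<^sup>2"
    using n by (simp add: field_simps power_mult_distrib)
  then show ?thesis
    by (rule power2_le_imp_le) (simp add: cnorm_ge_zero x y)
qed

end

section \<open>Square-summable families and abstract coordinates\<close>

definition sqsum :: "'i set \<Rightarrow> ('i \<Rightarrow> complex) set" where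
  "sqsum J = {a. (\<forall>i. i \<notin> J \<longrightarrow> a i = 0) \<and> (\<lambda>i. (cmod (a i))\<^sup>2) summable_on J}"

text \<open>This crude bound, summed over the index set, takes the place of the triangle inequality
  for square-summable families.\<close>

lemma cmod_add_square_le: "(cmod (a + b))\<^sup>2 \<le> 2 * (cmod a)\<^sup>2 + 2 * (cmod b)\<^sup>2"
proof -
  have "(cmod (a + b))\<^sup>2 \<le> (cmod a + cmod b)\<^sup>2"
    by (simp add: norm_triangle_ineq power_mono)
  also have "\<dots> \<le> 2 * (cmod a)\<^sup>2 + 2 * (cmod b)\<^sup>2"
    using sum_squares_bound[of "cmod a" "cmod b"] by (simp add: power2_sum)
  finally show ?thesis .
qed

lemma summable_on_real_comparison:
  fixes f g :: "'i \<Rightarrow> real"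
  assumes "g summable_on A" "\<And>i. i \<in> A \<Longrightarrow> 0 \<le> f i" "\<And>i. i \<in> A \<Longrightarrow> f i \<le> g i"
  shows "f summable_on A"
  by (rule summable_on_comparison_test[OF assms(1)]) (use assms in auto)

lemma csubspace_sqsum: "csubspace (sqsum J)"
proof -
  have "a + b \<in> sqsum J" if "a \<in> sqsum J" "b \<in> sqsum J" for a b
  proof -
    have "(\<lambda>i. 2 * (cmod (a i))\<^sup>2 + 2 * (cmod (b i))\<^sup>2) summable_on J"
      using that by (intro summable_on_add summable_on_cmult_right) (auto simp: sqsum_def)
    then have "(\<lambda>i. (cmod (a i + b i))\<^sup>2) summable_on J"
      by (rule summable_on_real_comparison) (auto intro: cmod_add_square_le)
    then show ?thesis using that by (auto simp: sqsum_def)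
  qed
  moreover have "c *\<^sub>C a \<in> sqsum J" if "a \<in> sqsum J" for a c
  proof -
    have "(\<lambda>i. (cmod c)\<^sup>2 * (cmod (a i))\<^sup>2) summable_on J"
      using that by (intro summable_on_cmult_right) (auto simp: sqsum_def)
    then show ?thesis using that
      by (auto simp: sqsum_def scaleC_fun_def scaleC_complex_def norm_mult power_mult_distrib)
  qed
  moreover have "0 \<in> sqsum J" by (simp add: sqsum_def)
  ultimately show ?thesis unfolding csubspace_def by blast
qed

lemma sqsum_mult_abs_summable:
  assumes "a \<in> sqsum J" "b \<in> sqsum J"
  shows "(\<lambda>i. cmod (a i * cnj (b i))) summable_on J"
proof -
  have "(\<lambda>i. (cmod (a i))\<^sup>2 + (cmod (b i))\<^sup>2) summable_on J"
    using assms by (intro summable_on_add) (auto simp: sqsum_def)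
  then show ?thesis
  proof (rule summable_on_real_comparison)
    fix i
    show "norm (a i * cnj (b i)) \<le> (cmod (a i))\<^sup>2 + (cmod (b i))\<^sup>2"
      using sum_squares_bound[of "cmod (a i)" "cmod (b i)"]
        mult_nonneg_nonneg[OF norm_ge_zero[of "a i"] norm_ge_zero[of "b i"]]
      unfolding norm_mult complex_mod_cnj by linarith
  qed simp
qed

definition delta :: "'i \<Rightarrow> 'i \<Rightarrow> complex" where "delta j = (\<lambda>i. if i = j then 1 else 0)"

lemma has_sum_single:
  assumes "j \<in> J" "\<And>i. i \<in> J \<Longrightarrow> i \<noteq> j \<Longrightarrow> f i = 0"
  shows "(f has_sum f j) J"
proof -
  have "(f has_sum f j) {j}" using has_sum_finite[of "{j}" f] by simp
  then show ?thesis
    using has_sum_cong_neutral[of "{j}" J f f "f j"] assms by auto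
qed

lemma delta_sqsum: "j \<in> J \<Longrightarrow> delta j \<in> sqsum J"
  using has_sum_single[of j J "\<lambda>i. (cmod (delta j i))\<^sup>2"]
  by (auto simp: sqsum_def delta_def summable_on_def)

text \<open>Families vanish off \<open>J\<close>, so \<open>\<Phi>\<close> can be a bijection onto a
  set of total functions. Only norms are tied to coordinates: boundedness, closed subspaces and
  isomorphisms see \<open>ip\<close> through \<open>cnorm\<close> alone, so the universality
  arguments can run in this locale, and for Hilbert--Schmidt operators only \<open>HS_ip\<close> of
  an operator with itself has to be computed.\<close>

locale l2_coords =
  fixes E :: "'v::complex_vector set" and ip :: "'v \<Rightarrow> 'v \<Rightarrow> complex"
    and J :: "'i set" and \<Phi> :: "'v \<Rightarrow> 'i \<Rightarrow> complex"
  assumes csubspace: "csubspace E"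
    and linear: "clinear_on E \<Phi>"
    and bij: "bij_betw \<Phi> E (sqsum J)"
    and square_has_sum: "x \<in> E \<Longrightarrow> ((\<lambda>i. (cmod (\<Phi> x i))\<^sup>2) has_sum Re (ip x x)) J"
begin

lemma coord_sqsum: "x \<in> E \<Longrightarrow> \<Phi> x \<in> sqsum J"
  using bij by (auto simp: bij_betw_def)

lemma coord_outside: "x \<in> E \<Longrightarrow> i \<notin> J \<Longrightarrow> \<Phi> x i = 0"
  using coord_sqsum by (auto simp: sqsum_def)

definition vec :: "('i \<Rightarrow> complex) \<Rightarrow> 'v" where "vec a = inv_into E \<Phi> a"

lemma vec_in: "a \<in> sqsum J \<Longrightarrow> vec a \<in> E"
  using bij_betw_imp_surj_on[OF bij] by (auto simp: vec_def intro: inv_into_into)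

lemma coord_vec: "a \<in> sqsum J \<Longrightarrow> \<Phi> (vec a) = a"
  using bij_betw_imp_surj_on[OF bij] by (auto simp: vec_def intro: f_inv_into_f)

lemma coord_inject: "x \<in> E \<Longrightarrow> y \<in> E \<Longrightarrow> \<Phi> x = \<Phi> y \<Longrightarrow> x = y"
  using bij by (auto simp: bij_betw_def dest: inj_onD)

lemma coord_eqI: "x \<in> E \<Longrightarrow> y \<in> E \<Longrightarrow> (\<And>i. i \<in> J \<Longrightarrow> \<Phi> x i = \<Phi> y i) \<Longrightarrow> x = y"
  by (rule coord_inject; (assumption | rule ext)?) (metis coord_outside)

lemma coord_add: "x \<in> E \<Longrightarrow> y \<in> E \<Longrightarrow> \<Phi> (x + y) i = \<Phi> x i + \<Phi> y i"
  using clinear_on_add[OF linear] by simp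

lemma coord_diff: "x \<in> E \<Longrightarrow> y \<in> E \<Longrightarrow> \<Phi> (x - y) i = \<Phi> x i - \<Phi> y i"
  using clinear_on_diff[OF linear csubspace] by simp

lemma coord_scale: "x \<in> E \<Longrightarrow> \<Phi> (c *\<^sub>C x) i = c * \<Phi> x i"
  using clinear_on_scale[OF linear] by (simp add: scaleC_fun_def scaleC_complex_def)

lemma coord_zero: "\<Phi> 0 i = 0"
  using clinear_on_zero[OF linear csubspace] by simp

lemma coord_sum: "(\<And>k. k \<in> F \<Longrightarrow> f k \<in> E) \<Longrightarrow> \<Phi> (\<Sum>k\<in>F. f k) i = (\<Sum>k\<in>F. \<Phi> (f k) i)"
  by (subst clinear_on_sum[OF linear csubspace]) (auto simp: sum_fun_apply)

lemma norm_has_sum: "x \<in> E \<Longrightarrow> ((\<lambda>i. (cmod (\<Phi> x i))\<^sup>2) has_sum (cnorm ip x)\<^sup>2) J"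
  using square_has_sum[of x] has_sum_nonneg[OF square_has_sum[of x]] by (simp add: cnorm_def)

lemma norm_nonneg: "x \<in> E \<Longrightarrow> cnorm ip x \<ge> 0"
  using has_sum_nonneg[OF square_has_sum[of x]] by (simp add: cnorm_def)

text \<open>Coordinates are continuous, so limits in norm can be identified coordinatewise, by
  uniqueness of limits in the complex numbers.\<close>

lemma coord_le_norm: "x \<in> E \<Longrightarrow> cmod (\<Phi> x i) \<le> cnorm ip x"
proof (cases "i \<in> J")
  case True
  assume x: "x \<in> E"
  have "(cmod (\<Phi> x i))\<^sup>2 \<le> (cnorm ip x)\<^sup>2"
    by (rule has_sum_mono_neutral[OF has_sum_single[of i "{i}" "\<lambda>i. (cmod (\<Phi> x i))\<^sup>2"] norm_has_sum[OF x]])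
      (use True in auto)
  then show ?thesis by (rule power2_le_imp_le) (rule norm_nonneg[OF x])
qed (simp add: coord_outside norm_nonneg)

lemma norm_zero: "cnorm ip 0 = 0"
proof -
  have "((\<lambda>i. (cmod (\<Phi> 0 i))\<^sup>2) has_sum 0) J" by (simp add: coord_zero)
  from has_sum_unique[OF this norm_has_sum] show ?thesis using csubspace_zero[OF csubspace] by simp
qed

lemma norm_scale: "x \<in> E \<Longrightarrow> cnorm ip (c *\<^sub>C x) = cmod c * cnorm ip x"
proof -
  assume x: "x \<in> E"
  have "((\<lambda>i. (cmod c)\<^sup>2 * (cmod (\<Phi> x i))\<^sup>2) has_sum (cmod c)\<^sup>2 * (cnorm ip x)\<^sup>2) J"
    by (intro has_sum_cmult_right norm_has_sum x)
  then have "((\<lambda>i. (cmod (\<Phi> (c *\<^sub>C x) i))\<^sup>2) has_sum (cmod c)\<^sup>2 * (cnorm ip x)\<^sup>2) J"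
    by (simp add: coord_scale x norm_mult power_mult_distrib)
  from has_sum_unique[OF norm_has_sum[OF csubspace_scale[OF csubspace x]] this]
  have "(cnorm ip (c *\<^sub>C x))\<^sup>2 = (cmod c * cnorm ip x)\<^sup>2"
    by (simp add: power_mult_distrib)
  then show ?thesis
    by (rule power2_eq_imp_eq)
      (use norm_nonneg[OF x] norm_nonneg[OF csubspace_scale[OF csubspace x]] in auto)
qed

lemma norm_add_square_le:
  assumes x: "x \<in> E" and y: "y \<in> E"
  shows "(cnorm ip (x + y))\<^sup>2 \<le> 2 * (cnorm ip x)\<^sup>2 + 2 * (cnorm ip y)\<^sup>2"
proof (rule has_sum_mono[OF norm_has_sum[OF csubspace_add[OF csubspace x y]]])
  show "((\<lambda>i. 2 * (cmod (\<Phi> x i))\<^sup>2 + 2 * (cmod (\<Phi> y i))\<^sup>2) has_sum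
      2 * (cnorm ip x)\<^sup>2 + 2 * (cnorm ip y)\<^sup>2) J"
    by (intro has_sum_add has_sum_cmult_right norm_has_sum x y)
qed (simp add: coord_add x y cmod_add_square_le)

definition basis :: "'i \<Rightarrow> 'v" where "basis j = vec (delta j)"

lemma basis_in: "j \<in> J \<Longrightarrow> basis j \<in> E"
  by (simp add: basis_def vec_in delta_sqsum)

lemma coord_basis: "j \<in> J \<Longrightarrow> \<Phi> (basis j) i = (if i = j then 1 else 0)"
  by (simp add: basis_def coord_vec delta_sqsum) (simp add: delta_def)

end

section \<open>Coordinates with respect to an orthonormal basis\<close>

lemma sqsum_boundedI:
  assumes "\<And>i. i \<notin> J \<Longrightarrow> a i = 0"
    and "\<And>F. finite F \<Longrightarrow> F \<subseteq> J \<Longrightarrow> (\<Sum>i\<in>F. (cmod (a i))\<^sup>2) \<le> C"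
  shows "a \<in> sqsum J"
  using assms(1) nonneg_bdd_above_summable_on[of J "\<lambda>i. (cmod (a i))\<^sup>2"] assms(2)
  by (auto simp: sqsum_def bdd_above_def)

lemma tendsto_finite_subsets_norm_zeroI:
  fixes f :: "'i set \<Rightarrow> 'a::real_normed_vector"
  assumes "\<And>e. e > 0 \<Longrightarrow> \<exists>F0. finite F0 \<and> F0 \<subseteq> J \<and> (\<forall>F. finite F \<and> F0 \<subseteq> F \<and> F \<subseteq> J \<longrightarrow> norm (f F - l) < e)"
  shows "(f \<longlongrightarrow> l) (finite_subsets_at_top J)"
  unfolding tendsto_iff eventually_finite_subsets_at_top dist_norm using assms by meson

text \<open>A unitary identification with square-summable families. It serves the spaces on which
  operators act, where adjoint vectors call for the full inner product and not just the
  norm.\<close>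

locale inner_coords =
  fixes K :: "'v::complex_vector set" and ip :: "'v \<Rightarrow> 'v \<Rightarrow> complex"
    and J :: "'i set" and \<Phi> :: "'v \<Rightarrow> 'i \<Rightarrow> complex"
  assumes csubspace': "csubspace K"
    and linear': "clinear_on K \<Phi>"
    and bij': "bij_betw \<Phi> K (sqsum J)"
    and ip_has_sum: "x \<in> K \<Longrightarrow> y \<in> K \<Longrightarrow> ((\<lambda>i. \<Phi> x i * cnj (\<Phi> y i)) has_sum ip x y) J"

sublocale inner_coords \<subseteq> l2_coords K ip J \<Phi>
proof
  fix x assume "x \<in> K"
  then have "((\<lambda>i. Re (\<Phi> x i * cnj (\<Phi> x i))) has_sum Re (ip x x)) J"
    by (intro has_sum_Re ip_has_sum)
  moreover have "Re (z * cnj z) = (cmod z)\<^sup>2" for z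
    by (metis Re_complex_of_real complex_norm_square)
  ultimately show "((\<lambda>i. (cmod (\<Phi> x i))\<^sup>2) has_sum Re (ip x x)) J" by simp
qed (use csubspace' linear' bij' in auto)

context inner_coords
begin

lemma inner_product_space: "inner_product_space K ip"
  unfolding inner_product_space_def
proof (intro conjI ballI allI impI)
  show "csubspace K" by (rule csubspace)
  fix x y assume xy: "x \<in> K" "y \<in> K"
  show "ip (x + y) z = ip x z + ip y z" if "z \<in> K" for z
    using has_sum_unique[OF ip_has_sum[OF csubspace_add[OF csubspace xy] that]
        has_sum_add[OF ip_has_sum[OF xy(1) that] ip_has_sum[OF xy(2) that],
          THEN has_sum_cong[THEN iffD1, rotated]]]
    by (simp add: coord_add xy algebra_simps)
  show "ip (c *\<^sub>C x) y = c * ip x y" for c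
    using has_sum_unique[OF ip_has_sum[OF csubspace_scale[OF csubspace xy(1)] xy(2)]
        has_sum_cmult_right[OF ip_has_sum[OF xy], THEN has_sum_cong[THEN iffD1, rotated]]]
    by (simp add: coord_scale xy algebra_simps)
  show "ip y x = cnj (ip x y)"
    using has_sum_unique[OF ip_has_sum[OF xy(2,1)]
        has_sum_cnj_iff[THEN iffD2, OF ip_has_sum[OF xy], THEN has_sum_cong[THEN iffD1, rotated]]]
    by (simp add: mult.commute)
next
  fix x assume x: "x \<in> K"
  show "0 \<le> Re (ip x x)" using has_sum_nonneg[OF square_has_sum[OF x]] by simp
  assume "ip x x = 0"
  then have "cnorm ip x = 0" by (simp add: cnorm_def)
  then have "\<Phi> x i = \<Phi> 0 i" for i using coord_le_norm[OF x, of i] coord_zero by simp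
  then show "x = 0" using coord_eqI[OF x csubspace_zero[OF csubspace]] by blast
qed

lemma ip_basis:
  assumes "x \<in> K" "j \<in> J" shows "ip x (basis j) = \<Phi> x j"
proof -
  have "((\<lambda>i. \<Phi> x i * cnj (\<Phi> (basis j) i)) has_sum \<Phi> x j) J"
    using has_sum_single[OF assms(2), of "\<lambda>i. \<Phi> x i * cnj (\<Phi> (basis j) i)"]
    by (simp add: coord_basis assms)
  then show ?thesis by (rule has_sum_unique[OF ip_has_sum[OF assms(1) basis_in[OF assms(2)]]])
qed

text \<open>The truncations \<open>pr F\<close> of the expansion of \<open>x\<close> converge to
  \<open>x\<close>: the squared distance is the squared norm minus the sum of the squared
  coordinates in \<open>F\<close>, hence a tail. A functional bounded by \<open>C\<close> then errs
  by at most \<open>C\<close> times the root of that tail.\<close>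

lemma functional_has_sum:
  assumes f: "clinear_on K (f :: 'v \<Rightarrow> complex)" and bound: "\<And>x. x \<in> K \<Longrightarrow> cmod (f x) \<le> C * cnorm ip x"
    and x: "x \<in> K"
  shows "((\<lambda>j. \<Phi> x j * f (basis j)) has_sum f x) J"
proof -
  define pr where "pr F = (\<Sum>j\<in>F. \<Phi> x j *\<^sub>C basis j)" for F
  have b: "\<Phi> x j *\<^sub>C basis j \<in> K" if "j \<in> J" for j
    using that by (intro csubspace_scale[OF csubspace] basis_in)
  have pr_in: "pr F \<in> K" if "F \<subseteq> J" for F
    unfolding pr_def using b that by (intro csubspace_sum[OF csubspace]) auto
  have pr_coord: "\<Phi> (pr F) i = (if i \<in> F then \<Phi> x i else 0)" if "finite F" "F \<subseteq> J" for F i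
  proof -
    have "\<Phi> (pr F) i = (\<Sum>j\<in>F. \<Phi> (\<Phi> x j *\<^sub>C basis j) i)"
      unfolding pr_def using b that by (intro coord_sum) auto
    also have "\<dots> = (\<Sum>j\<in>F. if i = j then \<Phi> x j else 0)"
      using that by (intro sum.cong refl) (auto simp: coord_scale basis_in coord_basis)
    also have "\<dots> = (if i \<in> F then \<Phi> x i else 0)" using that by simp
    finally show ?thesis .
  qed
  have dist: "(cnorm ip (x - pr F))\<^sup>2 = (cnorm ip x)\<^sup>2 - (\<Sum>j\<in>F. (cmod (\<Phi> x j))\<^sup>2)"
    if F: "finite F" "F \<subseteq> J" for F
  proof -
    have d: "x - pr F \<in> K" using csubspace_diff[OF csubspace x pr_in] F by blast
    have "((\<lambda>i. if i \<in> F then (cmod (\<Phi> x i))\<^sup>2 else 0) has_sum (\<Sum>j\<in>F. (cmod (\<Phi> x j))\<^sup>2)) J"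
      by (rule has_sum_cong_neutral[THEN iffD1, OF _ _ _ has_sum_finite[OF F(1)]]) (use F in auto)
    then have "((\<lambda>i. - (if i \<in> F then (cmod (\<Phi> x i))\<^sup>2 else 0)) has_sum - (\<Sum>j\<in>F. (cmod (\<Phi> x j))\<^sup>2)) J"
      by (simp only: has_sum_uminus minus_minus)
    from has_sum_add[OF norm_has_sum[OF x] this]
    have "((\<lambda>i. (cmod (\<Phi> x i))\<^sup>2 + - (if i \<in> F then (cmod (\<Phi> x i))\<^sup>2 else 0)) has_sum
        (cnorm ip x)\<^sup>2 - (\<Sum>j\<in>F. (cmod (\<Phi> x j))\<^sup>2)) J" by simp
    then have "((\<lambda>i. (cmod (\<Phi> (x - pr F) i))\<^sup>2) has_sum
        (cnorm ip x)\<^sup>2 - (\<Sum>j\<in>F. (cmod (\<Phi> x j))\<^sup>2)) J"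
      by (rule has_sum_cong[THEN iffD1, rotated]) (simp add: coord_diff x pr_in F pr_coord)
    then show ?thesis using has_sum_unique[OF norm_has_sum[OF d]] by simp
  qed
  have "((\<lambda>F. sqrt ((cnorm ip x)\<^sup>2 - (\<Sum>j\<in>F. (cmod (\<Phi> x j))\<^sup>2))) \<longlongrightarrow>
      sqrt ((cnorm ip x)\<^sup>2 - (cnorm ip x)\<^sup>2)) (finite_subsets_at_top J)"
    using norm_has_sum[OF x] unfolding has_sum_def by (intro tendsto_intros)
  then have "((\<lambda>F. C * sqrt ((cnorm ip x)\<^sup>2 - (\<Sum>j\<in>F. (cmod (\<Phi> x j))\<^sup>2))) \<longlongrightarrow> C * 0)
      (finite_subsets_at_top J)"
    by (intro tendsto_mult_left) simp
  then have lim: "((\<lambda>F. C * sqrt ((cnorm ip x)\<^sup>2 - (\<Sum>j\<in>F. (cmod (\<Phi> x j))\<^sup>2))) \<longlongrightarrow> 0)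
      (finite_subsets_at_top J)" by simp
  have "((\<lambda>F. (\<Sum>j\<in>F. \<Phi> x j * f (basis j)) - f x) \<longlongrightarrow> 0) (finite_subsets_at_top J)"
  proof (rule Lim_null_comparison[OF _ lim])
    show "\<forall>\<^sub>F F in finite_subsets_at_top J. cmod ((\<Sum>j\<in>F. \<Phi> x j * f (basis j)) - f x)
        \<le> C * sqrt ((cnorm ip x)\<^sup>2 - (\<Sum>j\<in>F. (cmod (\<Phi> x j))\<^sup>2))"
    proof (rule eventually_finite_subsets_at_top_weakI)
      fix F assume F: "finite F" "F \<subseteq> J"
      have d: "x - pr F \<in> K" using csubspace_diff[OF csubspace x pr_in] F by blast
      have "f (pr F) = (\<Sum>j\<in>F. f (\<Phi> x j *\<^sub>C basis j))"
        unfolding pr_def using b F by (intro clinear_on_sum[OF f csubspace]) auto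
      also have "\<dots> = (\<Sum>j\<in>F. \<Phi> x j * f (basis j))"
        using F by (intro sum.cong refl)
          (subst clinear_on_scale[OF f], auto simp: basis_in scaleC_complex_def)
      finally have "f (x - pr F) = f x - (\<Sum>j\<in>F. \<Phi> x j * f (basis j))"
        using clinear_on_diff[OF f csubspace x pr_in] F by simp
      then have "cmod ((\<Sum>j\<in>F. \<Phi> x j * f (basis j)) - f x) = cmod (f (x - pr F))"
        by (simp add: norm_minus_commute)
      also have "\<dots> \<le> C * cnorm ip (x - pr F)" by (rule bound[OF d])
      also have "cnorm ip (x - pr F) = sqrt ((cnorm ip x)\<^sup>2 - (\<Sum>j\<in>F. (cmod (\<Phi> x j))\<^sup>2))"
        using dist[OF F] norm_nonneg[OF d] by (metis real_sqrt_abs abs_of_nonneg)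
      finally show "cmod ((\<Sum>j\<in>F. \<Phi> x j * f (basis j)) - f x)
        \<le> C * sqrt ((cnorm ip x)\<^sup>2 - (\<Sum>j\<in>F. (cmod (\<Phi> x j))\<^sup>2))" .
    qed
  qed
  then show ?thesis unfolding has_sum_def by (rule LIM_zero_cancel)
qed

lemma complete: "complete_on K ip"
  unfolding complete_on_def
proof (intro allI impI)
  fix s :: "nat \<Rightarrow> 'v"
  assume s: "range s \<subseteq> K" and C: "\<forall>e>0. \<exists>N. \<forall>m\<ge>N. \<forall>n\<ge>N. cnorm ip (s m - s n) < e"
  have sK: "s n \<in> K" for n using s by auto
  have d: "s m - s n \<in> K" for m n by (intro csubspace_diff[OF csubspace] sK)
  have "Cauchy (\<lambda>n. \<Phi> (s n) i)" for i
    unfolding Cauchy_def dist_norm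
    using C coord_le_norm[OF d] coord_diff[OF sK sK] by (metis order_le_less_trans)
  then have "\<exists>l. (\<lambda>n. \<Phi> (s n) i) \<longlonglongrightarrow> l" for i
    by (simp add: Cauchy_convergent convergentD)
  then obtain a where a: "\<And>i. (\<lambda>n. \<Phi> (s n) i) \<longlonglongrightarrow> a i" by metis
  \<comment> \<open>For fixed finite \<open>F\<close> the bound survives the limit in
    \<open>n\<close>; letting \<open>F\<close> vary afterwards bounds the whole norm, and no limits
    are exchanged.\<close>
  have partial: "(\<Sum>i\<in>F. (cmod (\<Phi> (s m) i - a i))\<^sup>2) \<le> e\<^sup>2"
    if F: "finite F" "F \<subseteq> J" and e: "\<And>n. n \<ge> N \<Longrightarrow> cnorm ip (s m - s n) < e" for F e N m
  proof (rule tendsto_upperbound)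
    show "(\<lambda>n. \<Sum>i\<in>F. (cmod (\<Phi> (s m) i - \<Phi> (s n) i))\<^sup>2)
        \<longlonglongrightarrow> (\<Sum>i\<in>F. (cmod (\<Phi> (s m) i - a i))\<^sup>2)"
      by (intro tendsto_intros a)
    show "\<forall>\<^sub>F n in sequentially. (\<Sum>i\<in>F. (cmod (\<Phi> (s m) i - \<Phi> (s n) i))\<^sup>2) \<le> e\<^sup>2"
    proof (rule eventually_sequentiallyI)
      fix n assume "n \<ge> N"
      have "(\<Sum>i\<in>F. (cmod (\<Phi> (s m - s n) i))\<^sup>2) \<le> (cnorm ip (s m - s n))\<^sup>2"
        by (rule finite_sum_le_has_sum[OF norm_has_sum[OF d] F]) simp
      also have "\<dots> \<le> e\<^sup>2"
        using e[OF \<open>n \<ge> N\<close>] norm_nonneg[OF d] by (intro power_mono) (auto intro: less_imp_le)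
      finally show "(\<Sum>i\<in>F. (cmod (\<Phi> (s m) i - \<Phi> (s n) i))\<^sup>2) \<le> e\<^sup>2"
        by (simp add: coord_diff sK)
    qed
  qed simp
  have outside: "a i = 0" if "i \<notin> J" for i
    using a[of i] coord_outside[OF sK that] by (simp add: LIMSEQ_const_iff)
  obtain N1 where N1: "\<forall>m\<ge>N1. \<forall>n\<ge>N1. cnorm ip (s m - s n) < 1" using C zero_less_one by blast
  \<comment> \<open>Only the difference to one term of the sequence is bounded directly; the limit
    family is that term minus the difference.\<close>
  have "(\<lambda>i. \<Phi> (s N1) i - a i) \<in> sqsum J"
  proof (rule sqsum_boundedI)
    show "(\<Sum>i\<in>F. (cmod (\<Phi> (s N1) i - a i))\<^sup>2) \<le> 1\<^sup>2" if "finite F" "F \<subseteq> J" for F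
      by (rule partial[OF that, of N1]) (use N1 in auto)
  qed (simp add: outside coord_outside sK)
  from csubspace_diff[OF csubspace_sqsum coord_sqsum[OF sK[of N1]] this]
  have aJ: "a \<in> sqsum J" by (simp add: fun_diff_def)
  define l where "l = vec a"
  have l: "l \<in> K" "\<Phi> l = a" using aJ by (auto simp: l_def vec_in coord_vec)
  have dl: "s n - l \<in> K" for n by (intro csubspace_diff[OF csubspace] sK l)
  have "(\<lambda>n. cnorm ip (s n - l)) \<longlonglongrightarrow> 0"
  proof (rule LIMSEQ_I)
    fix r :: real assume "r > 0"
    then obtain N where N: "\<forall>m\<ge>N. \<forall>n\<ge>N. cnorm ip (s m - s n) < r / 2" using C half_gt_zero by blast
    have "cnorm ip (s m - l) < r" if "m \<ge> N" for m
    proof -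
      have "(cnorm ip (s m - l))\<^sup>2 \<le> (r / 2)\<^sup>2"
      proof (rule has_sum_le_finite_sums[OF norm_has_sum[OF dl]])
        fix F assume "finite F" "F \<subseteq> J"
        then show "(\<Sum>i\<in>F. (cmod (\<Phi> (s m - l) i))\<^sup>2) \<le> (r / 2)\<^sup>2"
          using partial[of F N m "r / 2"] N that by (simp add: coord_diff sK l)
      qed
      then have "cnorm ip (s m - l) \<le> r / 2" by (rule power2_le_imp_le) (use \<open>r > 0\<close> in simp)
      then show ?thesis using \<open>r > 0\<close> by simp
    qed
    then show "\<exists>no. \<forall>n\<ge>no. norm (cnorm ip (s n - l) - 0) < r"
      using norm_nonneg[OF dl] by (intro exI[of _ N]) simp
  qed
  then show "\<exists>l\<in>K. (\<lambda>n. cnorm ip (s n - l)) \<longlonglongrightarrow> 0" using l(1) by blast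
qed

lemma hilbert_space: "hilbert_space K ip"
  unfolding hilbert_space_def using inner_product_space complete by blast

end

section \<open>Orthonormal bases: existence, Riesz--Fischer and Parseval\<close>

lemma onb_exists:
  assumes V: "inner_product_space V ip" shows "\<exists>B. onb V ip B"
proof -
  define S where "S = {B. B \<subseteq> V \<and> (\<forall>e\<in>B. \<forall>f\<in>B. ip e f = (if e = f then 1 else 0))}"
  have "\<exists>M\<in>S. \<forall>X\<in>S. M \<subseteq> X \<longrightarrow> X = M"
  proof (rule subset_Zorn')
    fix C assume C: "subset.chain S C"
    have "ip e f = (if e = f then 1 else 0)" if ef: "e \<in> \<Union>C" "f \<in> \<Union>C" for e f
    proof -
      from ef obtain X Y where "X \<in> C" "e \<in> X" "Y \<in> C" "f \<in> Y" by auto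
      moreover have "X \<subseteq> Y \<or> Y \<subseteq> X" "X \<in> S" "Y \<in> S"
        using C \<open>X \<in> C\<close> \<open>Y \<in> C\<close> by (auto simp: subset_chain_def)
      ultimately show ?thesis unfolding S_def by blast
    qed
    moreover have "\<Union>C \<subseteq> V" using C by (auto simp: subset_chain_def S_def)
    ultimately show "\<Union>C \<in> S" by (simp add: S_def)
  qed
  then obtain B where B: "B \<in> S" and max: "\<And>X. X \<in> S \<Longrightarrow> B \<subseteq> X \<Longrightarrow> X = B" by blast
  have BV: "B \<subseteq> V" using B by (simp add: S_def)
  \<comment> \<open>A nonzero vector orthogonal to the maximal set would, once normalised, enlarge
    it.\<close>
  have "x = 0" if x: "x \<in> V" "\<forall>e\<in>B. ip x e = 0" for x
  proof (rule ccontr)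
    assume "x \<noteq> 0"
    then have n: "cnorm ip x > 0" using cnorm_eq_zero[OF V x(1)] cnorm_ge_zero[OF V x(1)] by force
    define u where "u = complex_of_real (1 / cnorm ip x) *\<^sub>C x"
    have u: "u \<in> V" unfolding u_def by (rule csubspace_scale[OF inner_product_space_csubspace[OF V] x(1)])
    have "cnorm ip u = 1" using n unfolding u_def cnorm_scale[OF V x(1)] by (simp add: norm_divide)
    then have uu: "ip u u = 1" using ip_self[OF V u] by simp
    have ue: "ip u e = 0" if "e \<in> B" for e
      using that x BV unfolding u_def by (subst ip_scale_left[OF V]) auto
    have eu: "ip e u = 0" if "e \<in> B" for e
      using ip_commute[OF V u, of e] ue[OF that] that BV by auto
    have "u \<notin> B" using ue uu by force
    have "insert u B \<in> S" using B u uu ue eu unfolding S_def by auto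
    then show False using max[of "insert u B"] \<open>u \<notin> B\<close> by blast
  qed
  then have "onb V ip B" using B unfolding onb_def S_def by blast
  then show ?thesis by blast
qed

lemma onb_some_onb: "inner_product_space V ip \<Longrightarrow> onb V ip (some_onb V ip)"
  unfolding some_onb_def by (rule someI_ex[OF onb_exists])

lemma onb_in: "onb V ip B \<Longrightarrow> e \<in> B \<Longrightarrow> e \<in> V"
  unfolding onb_def by (elim conjE) (rule subsetD)

lemma onb_orthonormal:
  "onb V ip B \<Longrightarrow> e \<in> B \<Longrightarrow> f \<in> B \<Longrightarrow> ip e f = (if e = f then 1 else 0)"
  unfolding onb_def by (elim conjE) (drule bspec, assumption, erule (1) bspec)

lemma onb_total: "onb V ip B \<Longrightarrow> x \<in> V \<Longrightarrow> (\<And>e. e \<in> B \<Longrightarrow> ip x e = 0) \<Longrightarrow> x = 0"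
  unfolding onb_def by (elim conjE) (drule (1) bspec, erule mp, rule ballI)

text \<open>\<open>onb\<close> asserts only that no nonzero vector is orthogonal to
  \<open>B\<close>; expansions must come from completeness. Riesz--Fischer produces a vector with
  the coefficients of \<open>x\<close> that is approximated by finite expansions, totality
  identifies it with \<open>x\<close>, and Parseval follows.\<close>

lemma onb_inner_coords:
  fixes V :: "'v::complex_vector set"
  assumes H: "hilbert_space V ip" and B: "onb V ip B"
  shows "inner_coords V ip B (\<lambda>x e. if e \<in> B then ip x e else 0)"
proof -
  have V: "inner_product_space V ip" and complete: "complete_on V ip"
    using H by (auto simp: hilbert_space_def)
  note sub = inner_product_space_csubspace[OF V]
  note BV = onb_in[OF B] and orth = onb_orthonormal[OF B] and total = onb_total[OF B]
  define pr where "pr c F = (\<Sum>e\<in>F. c e *\<^sub>C e)" for c and F :: "'v set"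
  have ce: "c *\<^sub>C e \<in> V" if "e \<in> B" for e c using csubspace_scale[OF sub BV[OF that]] .
  have pr_in: "pr c F \<in> V" if "F \<subseteq> B" for c F
    unfolding pr_def using ce that by (intro csubspace_sum[OF sub]) auto
  have ip_pr_left: "ip (pr c F) x = (\<Sum>e\<in>F. c e * ip e x)" if "F \<subseteq> B" "x \<in> V" for c F x
  proof -
    have "ip (pr c F) x = (\<Sum>e\<in>F. ip (c e *\<^sub>C e) x)"
      unfolding pr_def using ce that by (intro ip_sum_left[OF V]) auto
    also have "\<dots> = (\<Sum>e\<in>F. c e * ip e x)"
      using BV that by (intro sum.cong refl ip_scale_left[OF V]) auto
    finally show ?thesis .
  qed
  have ip_pr: "ip (pr c F) e = (if e \<in> F then c e else 0)" if F: "finite F" "F \<subseteq> B" and e: "e \<in> B" for c F e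
  proof -
    have "ip (pr c F) e = (\<Sum>f\<in>F. if f = e then c f else 0)"
      unfolding ip_pr_left[OF F(2) BV[OF e]] using F orth e by (intro sum.cong refl) auto
    then show ?thesis using F by simp
  qed
  have ip_pr_right: "ip x (pr c F) = (\<Sum>e\<in>F. cnj (c e) * ip x e)" if "F \<subseteq> B" "x \<in> V" for c F x
  proof -
    have "ip x (pr c F) = cnj (\<Sum>e\<in>F. c e * ip e x)"
      using ip_commute[OF V pr_in that(2)] ip_pr_left that by metis
    also have "\<dots> = (\<Sum>e\<in>F. cnj (c e) * ip x e)"
      unfolding cnj_sum using that BV by (intro sum.cong refl) (auto simp: ip_commute[OF V, of x])
    finally show ?thesis .
  qed
  have sq: "cnj z * z = of_real ((cmod z)\<^sup>2)" for z
    using complex_norm_square[of z] by (simp add: mult.commute)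
  have pr_norm: "(cnorm ip (pr c F))\<^sup>2 = (\<Sum>e\<in>F. (cmod (c e))\<^sup>2)" if F: "finite F" "F \<subseteq> B" for c F
  proof -
    have "complex_of_real ((cnorm ip (pr c F))\<^sup>2) = (\<Sum>e\<in>F. cnj (c e) * c e)"
      unfolding ip_self[OF V pr_in[OF F(2)], symmetric] ip_pr_right[OF F(2) pr_in[OF F(2)]]
      using F by (intro sum.cong refl) (subst ip_pr, auto)
    also have "\<dots> = of_real (\<Sum>e\<in>F. (cmod (c e))\<^sup>2)" by (simp only: sq of_real_sum)
    finally show ?thesis by (simp only: of_real_eq_iff)
  qed
  have dist: "(cnorm ip (x - pr (ip x) F))\<^sup>2 = (cnorm ip x)\<^sup>2 - (\<Sum>e\<in>F. (cmod (ip x e))\<^sup>2)"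
    if x: "x \<in> V" and F: "finite F" "F \<subseteq> B" for x F
  proof -
    have "ip x (pr (ip x) F) = of_real (\<Sum>e\<in>F. (cmod (ip x e))\<^sup>2)"
      unfolding ip_pr_right[OF F(2) x] by (simp only: sq of_real_sum)
    then show ?thesis unfolding cnorm_diff_square[OF V x pr_in[OF F(2)]] pr_norm[OF F] by simp
  qed
  have bessel: "(\<Sum>e\<in>F. (cmod (ip x e))\<^sup>2) \<le> (cnorm ip x)\<^sup>2"
    if "x \<in> V" "finite F" "F \<subseteq> B" for x F
    using dist[OF that] zero_le_power2[of "cnorm ip (x - pr (ip x) F)"] by linarith
  have riesz_fischer: "\<exists>x\<in>V. (\<forall>e\<in>B. ip x e = c e) \<and>
      (\<forall>r>0. \<exists>F. finite F \<and> F \<subseteq> B \<and> cnorm ip (x - pr c F) < r)" if c: "c \<in> sqsum B" for c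
  proof -
    define t where "t = (\<Sum>\<^sub>\<infinity>e\<in>B. (cmod (c e))\<^sup>2)"
    have t: "((\<lambda>e. (cmod (c e))\<^sup>2) has_sum t) B"
      using c unfolding t_def sqsum_def by simp
    have le_t: "(\<Sum>e\<in>F. (cmod (c e))\<^sup>2) \<le> t" if "finite F" "F \<subseteq> B" for F
      using finite_sum_le_has_sum[OF t that] by simp
    \<comment> \<open>The finite sets \<open>F n\<close> capture the total \<open>t\<close> up to
      \<open>1 / real (Suc n)\<close>. They need not be nested, and a sequence of them suffices even
      if \<open>B\<close> is uncountable.\<close>
    have "\<exists>F. finite F \<and> F \<subseteq> B \<and> t - (\<Sum>e\<in>F. (cmod (c e))\<^sup>2) < 1 / real (Suc n)" for n
    proof (rule ccontr)
      assume neg: "\<not> ?thesis"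
      have "(\<Sum>e\<in>F. (cmod (c e))\<^sup>2) \<le> t - 1 / real (Suc n)" if "finite F" "F \<subseteq> B" for F
      proof -
        have "\<not> t - (\<Sum>e\<in>F. (cmod (c e))\<^sup>2) < 1 / real (Suc n)" using neg that by blast
        then show ?thesis by linarith
      qed
      from has_sum_le_finite_sums[OF t this] have "1 / real (Suc n) \<le> 0" by simp
      then show False by (simp add: divide_le_0_iff)
    qed
    then obtain F where F: "\<And>n. finite (F n)" "\<And>n. F n \<subseteq> B"
      and Ft: "\<And>n. t - (\<Sum>e\<in>F n. (cmod (c e))\<^sup>2) < 1 / real (Suc n)" by metis
    define s where "s n = pr c (F n)" for n
    have sV: "s n \<in> V" for n unfolding s_def by (rule pr_in[OF F(2)])
    \<comment> \<open>The squared distance is the mass of the symmetric difference of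
      \<open>F m\<close> and \<open>F n\<close>; inclusion--exclusion bounds it, the mass of the
      union being at most \<open>t\<close>.\<close>
    have sdist: "(cnorm ip (s m - s n))\<^sup>2 \<le> 1 / real (Suc m) + 1 / real (Suc n)" for m n
    proof -
      let ?S = "\<lambda>A. \<Sum>e\<in>A. (cmod (c e))\<^sup>2"
      have "ip (s m) (s n) = (\<Sum>e\<in>F n. if e \<in> F m then complex_of_real ((cmod (c e))\<^sup>2) else 0)"
        unfolding s_def ip_pr_right[OF F(2) pr_in[OF F(2)]] using F(1,2)
        by (intro sum.cong refl) (subst ip_pr, auto simp: sq)
      also have "\<dots> = of_real (?S (F n \<inter> F m))"
        using sum.inter_restrict[OF F(1)[of n], of "\<lambda>e. complex_of_real ((cmod (c e))\<^sup>2)" "F m"] by simp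
      finally have "(cnorm ip (s m - s n))\<^sup>2 = ?S (F m) - 2 * ?S (F n \<inter> F m) + ?S (F n)"
        unfolding cnorm_diff_square[OF V sV sV] by (simp add: s_def pr_norm F)
      moreover have "?S (F n \<union> F m) + ?S (F n \<inter> F m) = ?S (F n) + ?S (F m)"
        by (rule sum.union_inter[OF F(1) F(1)])
      moreover have "?S (F n \<union> F m) \<le> t" using F by (intro le_t) auto
      ultimately show ?thesis using Ft[of m] Ft[of n] by linarith
    qed
    have "\<exists>N. \<forall>m\<ge>N. \<forall>n\<ge>N. cnorm ip (s m - s n) < e" if "e > 0" for e
    proof -
      obtain N where N: "inverse (real (Suc N)) < e\<^sup>2 / 2"
        using reals_Archimedean[of "e\<^sup>2 / 2"] \<open>e > 0\<close> zero_less_power[of e 2] by (meson half_gt_zero)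
      have "cnorm ip (s m - s n) < e" if "m \<ge> N" "n \<ge> N" for m n
      proof (rule power2_less_imp_less)
        have "1 / real (Suc k) \<le> inverse (real (Suc N))" if "k \<ge> N" for k
          using that by (simp add: field_simps)
        from this[OF that(1)] this[OF that(2)] N sdist[of m n]
        show "(cnorm ip (s m - s n))\<^sup>2 < e\<^sup>2" by linarith
      qed (use \<open>e > 0\<close> in simp)
      then show ?thesis by blast
    qed
    then obtain l where l: "l \<in> V" "(\<lambda>n. cnorm ip (s n - l)) \<longlonglongrightarrow> 0"
      using complete sV unfolding complete_on_def by blast
    have "ip l e = c e" if e: "e \<in> B" for e
    proof -
      have g1: "(\<lambda>n. cnorm ip (s n - l) * cnorm ip e) \<longlonglongrightarrow> 0"
        using tendsto_mult_right[OF l(2), of "cnorm ip e"] by simp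
      have "(\<lambda>n. ip (s n) e - ip l e) \<longlonglongrightarrow> 0"
      proof (rule Lim_null_comparison[OF always_eventually g1], rule allI)
        fix n
        have "s n - l \<in> V" by (intro csubspace_diff[OF sub] sV l)
        then show "norm (ip (s n) e - ip l e) \<le> cnorm ip (s n - l) * cnorm ip e"
          using ip_Cauchy_Schwarz[OF V _ BV[OF e], of "s n - l"] ip_diff_left[OF V sV l(1) BV[OF e]] by metis
      qed
      then have 1: "(\<lambda>n. ip (s n) e) \<longlonglongrightarrow> ip l e" by (rule LIM_zero_cancel)
      have "(\<lambda>n. sqrt (1 / real (Suc n))) \<longlonglongrightarrow> sqrt 0"
        by (intro tendsto_real_sqrt LIMSEQ_Suc[OF lim_1_over_n])
      then have g2: "(\<lambda>n. sqrt (1 / real (Suc n))) \<longlonglongrightarrow> 0" by simp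
      have "(\<lambda>n. ip (s n) e - c e) \<longlonglongrightarrow> 0"
      proof (rule Lim_null_comparison[OF always_eventually g2], rule allI)
        fix n
        have "(cmod (ip (s n) e - c e))\<^sup>2 \<le> 1 / real (Suc n)"
        proof (cases "e \<in> F n")
          case False
          \<comment> \<open>\<open>e\<close> was left out, so \<open>(cmod (c e))\<^sup>2\<close> is
            part of the mass missing from \<open>F n\<close>.\<close>
          then have "(\<Sum>f\<in>insert e (F n). (cmod (c f))\<^sup>2) = (cmod (c e))\<^sup>2 + (\<Sum>f\<in>F n. (cmod (c f))\<^sup>2)"
            using F(1) by simp
          moreover have "(\<Sum>f\<in>insert e (F n). (cmod (c f))\<^sup>2) \<le> t" using F e by (intro le_t) auto
          ultimately show ?thesis using Ft[of n] False by (simp add: s_def ip_pr F e)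
        qed (simp add: s_def ip_pr F e)
        then show "norm (ip (s n) e - c e) \<le> sqrt (1 / real (Suc n))" by (rule real_le_rsqrt)
      qed
      then have 2: "(\<lambda>n. ip (s n) e) \<longlonglongrightarrow> c e" by (rule LIM_zero_cancel)
      show ?thesis using LIMSEQ_unique[OF 1 2] .
    qed
    moreover have "\<exists>F. finite F \<and> F \<subseteq> B \<and> cnorm ip (l - pr c F) < r" if "r > 0" for r
    proof -
      obtain n where "norm (cnorm ip (s n - l) - 0) < r" using LIMSEQ_D[OF l(2) \<open>r > 0\<close>] by blast
      moreover have "cnorm ip (l - s n) = cnorm ip (s n - l)"
        using cnorm_scale[OF V csubspace_diff[OF sub sV l(1)], of "-1" n] by (simp add: scaleC_uminus_one)
      ultimately have "cnorm ip (l - pr c (F n)) < r" by (simp add: s_def)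
      then show ?thesis using F by blast
    qed
    ultimately show ?thesis using l(1) by blast
  qed
  let ?c = "\<lambda>x e. if e \<in> B then ip x e else 0"
  have c_sqsum: "?c x \<in> sqsum B" if "x \<in> V" for x
  proof (rule sqsum_boundedI)
    fix F assume F: "finite F" "F \<subseteq> B"
    have "(\<Sum>e\<in>F. (cmod (?c x e))\<^sup>2) = (\<Sum>e\<in>F. (cmod (ip x e))\<^sup>2)" using F by (intro sum.cong) auto
    then show "(\<Sum>e\<in>F. (cmod (?c x e))\<^sup>2) \<le> (cnorm ip x)\<^sup>2" using bessel[OF that F] by simp
  qed simp
  have inject: "x = y" if "x \<in> V" "y \<in> V" "\<And>e. e \<in> B \<Longrightarrow> ip x e = ip y e" for x y
    using total[OF csubspace_diff[OF sub that(1,2)]] ip_diff_left[OF V that(1,2) BV] that(3) by fastforce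
  have approx: "\<exists>F. finite F \<and> F \<subseteq> B \<and> cnorm ip (x - pr (ip x) F) < r" if x: "x \<in> V" and r: "r > 0" for x r
  proof -
    obtain y where y: "y \<in> V" "\<And>e. e \<in> B \<Longrightarrow> ip y e = ?c x e"
      and a: "\<And>r. r > 0 \<Longrightarrow> \<exists>F. finite F \<and> F \<subseteq> B \<and> cnorm ip (y - pr (?c x) F) < r"
      using riesz_fischer[OF c_sqsum[OF x]] by blast
    have "y = x" using inject[OF y(1) x] y(2) by simp
    moreover obtain F where F: "finite F" "F \<subseteq> B" "cnorm ip (y - pr (?c x) F) < r" using a[OF r] by blast
    moreover have "pr (?c x) F = pr (ip x) F" unfolding pr_def using F(2) by (intro sum.cong) auto
    ultimately show ?thesis by (metis (no_types))
  qed
  show ?thesis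
  proof
    show "csubspace V" by (rule sub)
    show "clinear_on V ?c"
      unfolding clinear_on_def using BV
      by (auto simp: fun_eq_iff scaleC_fun_def scaleC_complex_def ip_add_left[OF V] ip_scale_left[OF V])
    show "bij_betw ?c V (sqsum B)"
      unfolding bij_betw_def
    proof
      show "inj_on ?c V"
      proof (rule inj_onI)
        fix x y assume xy: "x \<in> V" "y \<in> V" and eq: "?c x = ?c y"
        have "ip x e = ip y e" if "e \<in> B" for e using fun_cong[OF eq, of e] that by simp
        then show "x = y" by (rule inject[OF xy])
      qed
      have "c \<in> ?c ` V" if c: "c \<in> sqsum B" for c
      proof -
        obtain x where x: "x \<in> V" "\<And>e. e \<in> B \<Longrightarrow> ip x e = c e" using riesz_fischer[OF c] by blast
        then have "c = ?c x" using c by (auto simp: sqsum_def)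
        then show ?thesis using x(1) by blast
      qed
      then show "?c ` V = sqsum B" using c_sqsum by blast
    qed
  next
    fix x y assume x: "x \<in> V" and y: "y \<in> V"
    have ny: "cnorm ip y + 1 > 0" using cnorm_ge_zero[OF V y] by linarith
    \<comment> \<open>Parseval: \<open>y\<close> is paired with the truncations of \<open>x\<close>,
      and Cauchy--Schwarz bounds the error. The factor \<open>cnorm ip y + 1\<close> keeps the
      division meaningful for \<open>y = 0\<close>.\<close>
    have "((\<lambda>e. ip x e * ip e y) has_sum ip x y) B"
      unfolding has_sum_def
    proof (rule tendsto_finite_subsets_norm_zeroI)
      fix r :: real assume r: "r > 0"
      obtain G where G: "finite G" "G \<subseteq> B" "cnorm ip (x - pr (ip x) G) < r / (cnorm ip y + 1)"
        using approx[OF x, of "r / (cnorm ip y + 1)"] r ny by auto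
      have "cmod ((\<Sum>e\<in>F. ip x e * ip e y) - ip x y) < r" if F: "finite F" "G \<subseteq> F" "F \<subseteq> B" for F
      proof -
        have p: "pr (ip x) F \<in> V" by (rule pr_in[OF F(3)])
        have "(cnorm ip (x - pr (ip x) F))\<^sup>2 \<le> (cnorm ip (x - pr (ip x) G))\<^sup>2"
          unfolding dist[OF x F(1,3)] dist[OF x G(1,2)] using F by (simp add: sum_mono2)
        then have le: "cnorm ip (x - pr (ip x) F) \<le> cnorm ip (x - pr (ip x) G)"
          by (rule power2_le_imp_le) (intro cnorm_ge_zero[OF V] csubspace_diff[OF sub] x pr_in G)
        have "cmod ((\<Sum>e\<in>F. ip x e * ip e y) - ip x y) = cmod (ip (x - pr (ip x) F) y)"
          unfolding ip_diff_left[OF V x p y] ip_pr_left[OF F(3) y] by (rule norm_minus_commute)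
        also have "\<dots> \<le> cnorm ip (x - pr (ip x) F) * cnorm ip y"
          by (intro ip_Cauchy_Schwarz[OF V] csubspace_diff[OF sub] x p y)
        also have "\<dots> \<le> cnorm ip (x - pr (ip x) G) * (cnorm ip y + 1)"
          using le cnorm_ge_zero[OF V y] cnorm_ge_zero[OF V csubspace_diff[OF sub x p]]
          by (intro mult_mono) auto
        also have "\<dots> < r" using G(3) ny by (simp add: pos_less_divide_eq)
        finally show ?thesis .
      qed
      then show "\<exists>F0. finite F0 \<and> F0 \<subseteq> B \<and> (\<forall>F. finite F \<and> F0 \<subseteq> F \<and> F \<subseteq> B \<longrightarrow>
          norm ((\<Sum>e\<in>F. ip x e * ip e y) - ip x y) < r)"
        using G by blast
    qed
    then show "((\<lambda>e. ?c x e * cnj (?c y e)) has_sum ip x y) B"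
      by (rule has_sum_cong[THEN iffD1, rotated]) (simp add: ip_commute[OF V y] BV)
  qed
qed

text \<open>Turns \<open>infinite_dim\<close> into infinitely many indices, the room that
  \<open>pair_universal\<close> needs. With a finite basis every vector would equal its finite
  expansion, and \<open>B\<close> would span.\<close>

lemma infinite_dim_onb:
  assumes H: "hilbert_space V ip" and inf: "infinite_dim V" and B: "onb V ip B"
  shows "infinite B"
proof
  assume fin: "finite B"
  interpret inner_coords V ip B "\<lambda>x e. if e \<in> B then ip x e else 0" by (rule onb_inner_coords[OF H B])
  have BV: "B \<subseteq> V" using onb_in[OF B] by blast
  note orth = onb_orthonormal[OF B]
  have "V \<subseteq> cspan B"
  proof
    fix x assume x: "x \<in> V"
    have b: "ip x e *\<^sub>C e \<in> V" if "e \<in> B" for e using csubspace_scale[OF csubspace] BV that by blast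
    have "x = (\<Sum>e\<in>B. ip x e *\<^sub>C e)"
    proof (rule coord_eqI[OF x csubspace_sum[OF csubspace]])
      fix i assume i: "i \<in> B"
      have "ip (\<Sum>e\<in>B. ip x e *\<^sub>C e) i = (\<Sum>e\<in>B. ip (ip x e *\<^sub>C e) i)"
        using b BV i by (intro ip_sum_left[OF inner_product_space]) auto
      also have "\<dots> = (\<Sum>e\<in>B. if e = i then ip x e else 0)"
        using BV i orth by (intro sum.cong refl) (subst ip_scale_left[OF inner_product_space], auto)
      also have "\<dots> = ip x i" using i fin by simp
      finally show "(if i \<in> B then ip x i else 0) =
          (if i \<in> B then ip (\<Sum>e\<in>B. ip x e *\<^sub>C e) i else 0)" by simp
    qed (use b in auto)
    then show "x \<in> cspan B" unfolding cspan_def by blast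
  qed
  then show False using inf fin BV unfolding infinite_dim_def by blast
qed

section \<open>Coordinates of sequence spaces and of Hilbert--Schmidt operators\<close>

text \<open>A sequence of vectors is a doubly indexed family. Norms and inner products agree by
  Fubini for sums over \<open>UNIV \<times> I\<close>, which holds for squares by nonnegativity and
  for inner products by absolute summability.\<close>

lemma ell2_inner_coords:
  assumes "inner_coords H ipH I \<phi>"
  shows "inner_coords (ell2 H ipH) (ell2_ip ipH) (UNIV \<times> I) (\<lambda>x (n, h). \<phi> (x n) h)"
proof -
  interpret H: inner_coords H ipH I \<phi> by (rule assms)
  let ?\<Phi> = "\<lambda>x (n, h). \<phi> (x n) h"
  have mem: "x n \<in> H" if "x \<in> ell2 H ipH" for x n using that by (simp add: ell2_def)
  have sum: "summable (\<lambda>n. (cnorm ipH (x n))\<^sup>2)" if "x \<in> ell2 H ipH" for x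
    using that by (simp add: ell2_def)
  have \<Phi>_sqsum: "?\<Phi> x \<in> sqsum (UNIV \<times> I)" if x: "x \<in> ell2 H ipH" for x
  proof -
    have "(\<lambda>n. (cnorm ipH (x n))\<^sup>2) summable_on UNIV"
      by (rule summable_nonneg_imp_summable_on[OF sum[OF x]]) simp
    then have "(\<lambda>(n, h). (cmod (\<phi> (x n) h))\<^sup>2) summable_on (UNIV \<times> I)"
      by (intro summable_on_SigmaI[where g = "\<lambda>n. (cnorm ipH (x n))\<^sup>2"])
        (auto intro: H.norm_has_sum mem[OF x])
    then show ?thesis
      by (auto simp: sqsum_def case_prod_unfold H.coord_outside mem[OF x])
  qed
  show ?thesis
  proof
    show "csubspace (ell2 H ipH)"
      unfolding csubspace_def
    proof (intro conjI ballI allI)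
      show "0 \<in> ell2 H ipH"
        using csubspace_zero[OF H.csubspace] H.norm_zero by (simp add: ell2_def)
      fix x assume x: "x \<in> ell2 H ipH"
      show "x + y \<in> ell2 H ipH" if y: "y \<in> ell2 H ipH" for y
      proof -
        have "summable (\<lambda>n. 2 * (cnorm ipH (x n))\<^sup>2 + 2 * (cnorm ipH (y n))\<^sup>2)"
          by (intro summable_add summable_mult sum x y)
        then have "summable (\<lambda>n. (cnorm ipH (x n + y n))\<^sup>2)"
          by (rule summable_comparison_test_ev[rotated])
            (intro always_eventually allI, simp add: H.norm_add_square_le mem x y)
        then show ?thesis using csubspace_add[OF H.csubspace mem[OF x] mem[OF y]] by (simp add: ell2_def)
      qed
      show "c *\<^sub>C x \<in> ell2 H ipH" for c
        using csubspace_scale[OF H.csubspace mem[OF x]] summable_mult[OF sum[OF x], of "(cmod c)\<^sup>2"]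
        by (simp add: ell2_def scaleC_fun_def H.norm_scale mem[OF x] power_mult_distrib)
    qed
    show "clinear_on (ell2 H ipH) ?\<Phi>"
      unfolding clinear_on_def
      by (auto simp: fun_eq_iff scaleC_fun_def scaleC_complex_def H.coord_add H.coord_scale mem)
    show "bij_betw ?\<Phi> (ell2 H ipH) (sqsum (UNIV \<times> I))"
      unfolding bij_betw_def
    proof
      show "inj_on ?\<Phi> (ell2 H ipH)"
      proof (rule inj_onI)
        fix x y assume xy: "x \<in> ell2 H ipH" "y \<in> ell2 H ipH" and eq: "?\<Phi> x = ?\<Phi> y"
        have "\<phi> (x n) h = \<phi> (y n) h" for n h using fun_cong[OF eq, of "(n, h)"] by simp
        then show "x = y" by (intro ext H.coord_eqI mem xy)
      qed
      have "a \<in> ?\<Phi> ` ell2 H ipH" if a: "a \<in> sqsum (UNIV \<times> I)" for a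
      proof -
        have S: "(\<lambda>p. (cmod (a p))\<^sup>2) summable_on (UNIV \<times> I)" using a by (simp add: sqsum_def)
        have sec: "(\<lambda>h. a (n, h)) \<in> sqsum I" for n
          using a summable_on_SigmaD1[of "\<lambda>n h. (cmod (a (n, h)))\<^sup>2" UNIV "\<lambda>_. I" n] S
          by (simp add: sqsum_def case_prod_unfold)
        define x where "x n = H.vec (\<lambda>h. a (n, h))" for n
        have xH: "x n \<in> H" and xc: "\<phi> (x n) h = a (n, h)" for n h
          using H.vec_in[OF sec] H.coord_vec[OF sec] by (auto simp: x_def)
        obtain t where "((\<lambda>p. (cmod (a p))\<^sup>2) has_sum t) (UNIV \<times> I)"
          using S by (auto simp: summable_on_def)
        then have "((\<lambda>n. (cnorm ipH (x n))\<^sup>2) has_sum t) UNIV"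
          by (rule has_sum_SigmaD) (use H.norm_has_sum[OF xH] in \<open>simp add: xc\<close>)
        then have "summable (\<lambda>n. (cnorm ipH (x n))\<^sup>2)"
          using has_sum_imp_sums sums_summable by blast
        then have "x \<in> ell2 H ipH" using xH by (simp add: ell2_def)
        moreover have "a = ?\<Phi> x" by (auto simp: xc)
        ultimately show ?thesis by blast
      qed
      then show "?\<Phi> ` ell2 H ipH = sqsum (UNIV \<times> I)" using \<Phi>_sqsum by blast
    qed
    fix x y assume x: "x \<in> ell2 H ipH" and y: "y \<in> ell2 H ipH"
    obtain t where t: "((\<lambda>i. ?\<Phi> x i * cnj (?\<Phi> y i)) has_sum t) (UNIV \<times> I)"
      using abs_summable_summable[OF sqsum_mult_abs_summable[OF \<Phi>_sqsum[OF x] \<Phi>_sqsum[OF y]]]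
      by (auto simp: summable_on_def)
    then have "((\<lambda>n. ipH (x n) (y n)) has_sum t) UNIV"
      by (rule has_sum_SigmaD) (simp add: H.ip_has_sum mem x y)
    then have "ell2_ip ipH x y = t"
      unfolding ell2_ip_def using has_sum_imp_sums sums_unique by metis
    then show "((\<lambda>i. ?\<Phi> x i * cnj (?\<Phi> y i)) has_sum ell2_ip ipH x y) (UNIV \<times> I)" using t by simp
  qed
qed

text \<open>The one-point index set makes the scalar space \<open>l2\<close> the instance
  \<open>I = {()}\<close> of the vector-valued construction.\<close>

lemma complex_inner_coords: "inner_coords UNIV ip_C {()} (\<lambda>x _. x)"
proof
  show "csubspace (UNIV :: complex set)" by (simp add: csubspace_def)
  show "clinear_on UNIV (\<lambda>x _. x)" by (auto simp: clinear_on_def scaleC_fun_def)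
  have "a \<in> range (\<lambda>x _. x)" for a :: "unit \<Rightarrow> complex"
    by (rule range_eqI[of _ _ "a ()"]) auto
  then show "bij_betw (\<lambda>x _. x) UNIV (sqsum {()})"
    by (auto simp: bij_betw_def inj_on_def fun_eq_iff sqsum_def)
  show "((\<lambda>i. x * cnj y) has_sum ip_C x y) {()}" for x y
    using has_sum_finite[of "{()}" "\<lambda>_. x * cnj y"] by (simp add: ip_C_def)
qed

section \<open>Bounded operators in coordinates\<close>

context l2_coords
begin

lemma bounded_squareI:
  assumes "C \<ge> 0" "\<And>x. x \<in> E \<Longrightarrow> T x \<in> E" "\<And>x. x \<in> E \<Longrightarrow> (cnorm ip (T x))\<^sup>2 \<le> C * (cnorm ip x)\<^sup>2"
  shows "\<exists>B. \<forall>x\<in>E. cnorm ip (T x) \<le> B * cnorm ip x"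
proof (intro exI ballI)
  fix x assume x: "x \<in> E"
  have "(cnorm ip (T x))\<^sup>2 \<le> (sqrt C * cnorm ip x)\<^sup>2"
    using assms(1) assms(3)[OF x] by (simp add: power_mult_distrib)
  then show "cnorm ip (T x) \<le> sqrt C * cnorm ip x"
    by (rule power2_le_imp_le) (use assms(1) norm_nonneg[OF x] in simp)
qed

lemma bounded_opI:
  assumes "C \<ge> 0" "\<And>x. x \<in> E \<Longrightarrow> T x \<in> E" "clinear_on E T"
    "\<And>x. x \<in> E \<Longrightarrow> (cnorm ip (T x))\<^sup>2 \<le> C * (cnorm ip x)\<^sup>2"
  shows "bounded_op E ip T"
  unfolding bounded_op_def using assms bounded_squareI[of C T] by blast

lemma bounded_opE:
  assumes "bounded_op E ip T"
  obtains C where "C > 0" "\<And>x. x \<in> E \<Longrightarrow> cnorm ip (T x) \<le> C * cnorm ip x"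
proof -
  obtain B where B: "\<And>x. x \<in> E \<Longrightarrow> cnorm ip (T x) \<le> B * cnorm ip x"
    using assms unfolding bounded_op_def by blast
  \<comment> \<open>The constant is enlarged to be positive, since \<open>scale_to_half\<close>
    divides by it.\<close>
  have "cnorm ip (T x) \<le> (\<bar>B\<bar> + 1) * cnorm ip x" if "x \<in> E" for x
  proof -
    have "B * cnorm ip x \<le> (\<bar>B\<bar> + 1) * cnorm ip x"
      using norm_nonneg[OF that] by (intro mult_right_mono) auto
    then show ?thesis using B[OF that] by linarith
  qed
  then show ?thesis using that[of "\<bar>B\<bar> + 1"] by auto
qed

lemma bounded_op_in: "bounded_op E ip T \<Longrightarrow> x \<in> E \<Longrightarrow> T x \<in> E"
  and bounded_op_clinear: "bounded_op E ip T \<Longrightarrow> clinear_on E T"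
  by (auto simp: bounded_op_def)

lemma bounded_op_add:
  assumes S: "bounded_op E ip S" and T: "bounded_op E ip T" shows "bounded_op E ip (S + T)"
proof -
  obtain B where B: "B > 0" "\<And>x. x \<in> E \<Longrightarrow> cnorm ip (S x) \<le> B * cnorm ip x" by (rule bounded_opE[OF S]) blast
  obtain C where C: "C > 0" "\<And>x. x \<in> E \<Longrightarrow> cnorm ip (T x) \<le> C * cnorm ip x" by (rule bounded_opE[OF T]) blast
  show ?thesis
  proof (rule bounded_opI)
    show "clinear_on E (S + T)"
      using bounded_op_clinear[OF S] bounded_op_clinear[OF T]
      by (auto simp: clinear_on_def scaleC_add_right)
    fix x assume x: "x \<in> E"
    show "(S + T) x \<in> E"
      using csubspace_add[OF csubspace] bounded_op_in[OF S x] bounded_op_in[OF T x] by simp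
    have "(cnorm ip (S x))\<^sup>2 \<le> (B * cnorm ip x)\<^sup>2" "(cnorm ip (T x))\<^sup>2 \<le> (C * cnorm ip x)\<^sup>2"
      using B C x norm_nonneg bounded_op_in[OF S x] bounded_op_in[OF T x] by (auto intro!: power_mono)
    then show "(cnorm ip ((S + T) x))\<^sup>2 \<le> (2 * B\<^sup>2 + 2 * C\<^sup>2) * (cnorm ip x)\<^sup>2"
      using norm_add_square_le[OF bounded_op_in[OF S x] bounded_op_in[OF T x]]
      by (simp add: power_mult_distrib algebra_simps)
  qed simp
qed

lemma bounded_op_scale:
  assumes T: "bounded_op E ip T" shows "bounded_op E ip (c *\<^sub>C T)"
proof -
  obtain C where C: "C > 0" "\<And>x. x \<in> E \<Longrightarrow> cnorm ip (T x) \<le> C * cnorm ip x" by (rule bounded_opE[OF T]) blast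
  show ?thesis
  proof (rule bounded_opI)
    show "clinear_on E (c *\<^sub>C T)"
      using bounded_op_clinear[OF T]
      by (auto simp: clinear_on_def scaleC_add_right scaleC_fun_def scaleC_scaleC mult.commute)
    fix x assume x: "x \<in> E"
    show "(c *\<^sub>C T) x \<in> E"
      using csubspace_scale[OF csubspace bounded_op_in[OF T x]] by (simp add: scaleC_fun_def)
    have "(cnorm ip (T x))\<^sup>2 \<le> (C * cnorm ip x)\<^sup>2"
      using C x norm_nonneg bounded_op_in[OF T x] by (auto intro!: power_mono)
    then have "(cmod c)\<^sup>2 * (cnorm ip (T x))\<^sup>2 \<le> (cmod c)\<^sup>2 * (C * cnorm ip x)\<^sup>2"
      by (rule mult_left_mono) simp
    then show "(cnorm ip ((c *\<^sub>C T) x))\<^sup>2 \<le> ((cmod c)\<^sup>2 * C\<^sup>2) * (cnorm ip x)\<^sup>2"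
      using norm_scale[OF bounded_op_in[OF T x]]
      by (simp add: power_mult_distrib scaleC_fun_def mult.assoc)
  qed simp
qed

end

section \<open>Adjoints and basis independence of the Hilbert--Schmidt norm\<close>

context inner_coords
begin

text \<open>The vector is the adjoint of \<open>T\<close> applied to \<open>y\<close>, built from
  its coordinates. The assumption on the basis images makes these square-summable, by
  Cauchy--Schwarz; \<open>functional_has_sum\<close> then shows that pairing with the resulting
  vector computes \<open>ip (T x) y\<close>.\<close>

lemma adjoint_vector:
  assumes T: "bounded_op K ip T" and S: "(\<lambda>j. (cnorm ip (T (basis j)))\<^sup>2) summable_on J" and y: "y \<in> K"
  shows "\<exists>z\<in>K. \<forall>x\<in>K. ip (T x) y = ip x z"
proof -
  note V = inner_product_space
  obtain C where C: "C > 0" "\<And>x. x \<in> K \<Longrightarrow> cnorm ip (T x) \<le> C * cnorm ip x" by (rule bounded_opE[OF T]) blast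
  note TK = bounded_op_in[OF T]
  have CS: "cmod (ip (T x) y) \<le> cnorm ip (T x) * cnorm ip y" if "x \<in> K" for x
    by (intro ip_Cauchy_Schwarz[OF V] TK that y)
  define a where "a j = (if j \<in> J then cnj (ip (T (basis j)) y) else 0)" for j
  have "(\<lambda>j. (cmod (a j))\<^sup>2) summable_on J"
  proof (rule summable_on_real_comparison)
    show "(\<lambda>j. (cnorm ip (T (basis j)))\<^sup>2 * (cnorm ip y)\<^sup>2) summable_on J"
      by (intro summable_on_cmult_left S)
    fix j assume "j \<in> J"
    then have "(cmod (ip (T (basis j)) y))\<^sup>2 \<le> (cnorm ip (T (basis j)) * cnorm ip y)\<^sup>2"
      by (intro power_mono CS basis_in) auto
    then show "(cmod (a j))\<^sup>2 \<le> (cnorm ip (T (basis j)))\<^sup>2 * (cnorm ip y)\<^sup>2"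
      using \<open>j \<in> J\<close> by (simp add: a_def power_mult_distrib)
  qed simp
  then have a: "a \<in> sqsum J" by (simp add: sqsum_def a_def)
  have "ip (T x) y = ip x (vec a)" if x: "x \<in> K" for x
  proof -
    have "((\<lambda>j. \<Phi> x j * ip (T (basis j)) y) has_sum ip (T x) y) J"
    proof (rule functional_has_sum[OF _ _ x])
      show "clinear_on K (\<lambda>x. ip (T x) y)"
        using bounded_op_clinear[OF T] TK y
        by (auto simp: clinear_on_def ip_add_left[OF V] ip_scale_left[OF V] scaleC_complex_def)
      fix x assume x: "x \<in> K"
      have "cnorm ip (T x) * cnorm ip y \<le> (C * cnorm ip x) * cnorm ip y"
        by (intro mult_right_mono C norm_nonneg x y)
      then show "cmod (ip (T x) y) \<le> (C * cnorm ip y) * cnorm ip x"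
        using CS[OF x] by (simp add: mult_ac)
    qed
    then have "((\<lambda>j. \<Phi> x j * cnj (\<Phi> (vec a) j)) has_sum ip (T x) y) J"
      by (rule has_sum_cong[THEN iffD1, rotated]) (simp add: coord_vec[OF a] a_def)
    from has_sum_unique[OF this ip_has_sum[OF x vec_in[OF a]]] show ?thesis .
  qed
  then show ?thesis using vec_in[OF a] by blast
qed

text \<open>Each coordinate of the image is a bounded functional, so
  \<open>functional_has_sum\<close> recovers it from the values on the basis.\<close>

lemma bounded_op_basis_eq:
  assumes S: "bounded_op K ip S" and T: "bounded_op K ip T"
    and eq: "\<And>j. j \<in> J \<Longrightarrow> S (basis j) = T (basis j)" and x: "x \<in> K"
  shows "S x = T x"
proof (rule coord_eqI[OF bounded_op_in[OF S x] bounded_op_in[OF T x]])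
  fix i
  have *: "((\<lambda>j. \<Phi> x j * \<Phi> (U (basis j)) i) has_sum \<Phi> (U x) i) J" if U: "bounded_op K ip U" for U
  proof -
    obtain C where C: "C > 0" "\<And>x. x \<in> K \<Longrightarrow> cnorm ip (U x) \<le> C * cnorm ip x" by (rule bounded_opE[OF U]) blast
    show ?thesis
    proof (rule functional_has_sum[OF _ _ x])
      show "clinear_on K (\<lambda>x. \<Phi> (U x) i)"
        using bounded_op_clinear[OF U] bounded_op_in[OF U]
        by (auto simp: clinear_on_def coord_add coord_scale scaleC_complex_def)
      show "cmod (\<Phi> (U x) i) \<le> C * cnorm ip x" if "x \<in> K" for x
        using coord_le_norm[OF bounded_op_in[OF U that], of i] C(2)[OF that] by linarith
    qed
  qed
  have "((\<lambda>j. \<Phi> x j * \<Phi> (T (basis j)) i) has_sum \<Phi> (S x) i) J"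
    using *[OF S] by (rule has_sum_cong[THEN iffD1, rotated]) (simp add: eq)
  from has_sum_unique[OF this *[OF T]] show "\<Phi> (S x) i = \<Phi> (T x) i" .
qed

end

text \<open>Both sums equal the Hilbert--Schmidt norm of the adjoint of \<open>T\<close> in the second basis.\<close>

lemma hs_norm_basis_independent:
  assumes "inner_coords K ip J \<Phi>" and "inner_coords K ip J' \<Phi>'"
    and T: "bounded_op K ip T"
    and S: "((\<lambda>j. (cnorm ip (T (l2_coords.basis K \<Phi> j)))\<^sup>2) has_sum s) J"
  shows "((\<lambda>j. (cnorm ip (T (l2_coords.basis K \<Phi>' j)))\<^sup>2) has_sum s) J'"
proof -
  interpret A: inner_coords K ip J \<Phi> by fact
  interpret B: inner_coords K ip J' \<Phi>' by fact
  note V = A.inner_product_space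
  note TK = A.bounded_op_in[OF T]
  \<comment> \<open>\<open>z k\<close> will be the adjoint of \<open>T\<close> applied to vector
    \<open>k\<close> of the second basis. Its existence rests on summability in the first
    basis.\<close>
  have "\<exists>z. z \<in> K \<and> (\<forall>x\<in>K. ip (T x) (B.basis k) = ip x z)" if "k \<in> J'" for k
    using A.adjoint_vector[OF T _ B.basis_in[OF that]] S by (auto simp: summable_on_def)
  then obtain z where z: "\<And>k. k \<in> J' \<Longrightarrow> z k \<in> K"
    "\<And>k x. k \<in> J' \<Longrightarrow> x \<in> K \<Longrightarrow> ip (T x) (B.basis k) = ip x (z k)" by metis
  have zc: "cmod (ip (z k) x) = cmod (ip (T x) (B.basis k))" if "k \<in> J'" "x \<in> K" for k x
    using z that ip_commute[OF V that(2) z(1)[OF that(1)]] by simp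
  let ?f = "\<lambda>(j, k). (cmod (\<Phi>' (T (A.basis j)) k))\<^sup>2"
  have sec: "((\<lambda>k. ?f (j, k)) has_sum (cnorm ip (T (A.basis j)))\<^sup>2) J'" if "j \<in> J" for j
    using B.norm_has_sum[OF TK[OF A.basis_in[OF that]]] by simp
  have "?f summable_on J \<times> J'"
    by (rule summable_on_SigmaI[OF sec]) (use S in \<open>auto simp: summable_on_def\<close>)
  with sec S have "(?f has_sum s) (J \<times> J')" by (rule has_sum_SigmaI)
  then have "((\<lambda>(k, j). ?f (j, k)) has_sum s) (J' \<times> J)" by (rule has_sum_swap[THEN iffD1])
  then have adj: "((\<lambda>k. (cnorm ip (z k))\<^sup>2) has_sum s) J'"
  proof (rule has_sum_SigmaD)
    fix k assume k: "k \<in> J'"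
    show "((\<lambda>j. case (k, j) of (k, j) \<Rightarrow> ?f (j, k)) has_sum (cnorm ip (z k))\<^sup>2) J"
      using A.norm_has_sum[OF z(1)[OF k]]
      by (rule has_sum_cong[THEN iffD1, rotated])
        (simp add: A.ip_basis[symmetric] B.ip_basis[symmetric] z k zc A.basis_in TK)
  qed
  \<comment> \<open>Now the second basis is used on both sides: the norms of the \<open>z k\<close>,
    expanded in it and resummed in the other order, give back the norms of the images under
    \<open>T\<close>.\<close>
  let ?g = "\<lambda>(k, l). (cmod (\<Phi>' (T (B.basis l)) k))\<^sup>2"
  have sec': "((\<lambda>l. ?g (k, l)) has_sum (cnorm ip (z k))\<^sup>2) J'" if k: "k \<in> J'" for k
    using B.norm_has_sum[OF z(1)[OF k]]
    by (rule has_sum_cong[THEN iffD1, rotated])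
      (simp add: B.ip_basis[symmetric] z k zc B.basis_in TK)
  have "?g summable_on J' \<times> J'"
    by (rule summable_on_SigmaI[OF sec']) (use adj in \<open>auto simp: summable_on_def\<close>)
  with sec' adj have "(?g has_sum s) (J' \<times> J')" by (rule has_sum_SigmaI)
  then have "((\<lambda>(l, k). ?g (k, l)) has_sum s) (J' \<times> J')" by (rule has_sum_swap[THEN iffD1])
  then show ?thesis
    by (rule has_sum_SigmaD) (use B.norm_has_sum[OF TK[OF B.basis_in]] in simp)
qed

section \<open>The matrix of a Hilbert--Schmidt operator\<close>

context inner_coords
begin

text \<open>Frees \<open>HS\<close> and \<open>HS_ip\<close> from the unspecified choice in
  \<open>some_onb\<close>: from here on the basis of the given coordinates may be used.\<close>

lemma hs_norm_some_onb:
  assumes T: "bounded_op K ip T"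
  shows "((\<lambda>e. (cnorm ip (T e))\<^sup>2) has_sum s) (some_onb K ip) \<longleftrightarrow>
    ((\<lambda>j. (cnorm ip (T (basis j)))\<^sup>2) has_sum s) J"
proof -
  let ?B = "some_onb K ip"
  have onb: "onb K ip ?B" by (rule onb_some_onb[OF inner_product_space])
  have co: "inner_coords K ip ?B (\<lambda>x e. if e \<in> ?B then ip x e else 0)"
    by (rule onb_inner_coords[OF hilbert_space onb])
  interpret B: inner_coords K ip ?B "\<lambda>x e. if e \<in> ?B then ip x e else 0" by (rule co)
  \<comment> \<open>The basis vector that these coordinates attach to the index \<open>e\<close> is
    \<open>e\<close> itself.\<close>
  have "B.basis e = e" if e: "e \<in> ?B" for e
  proof (rule B.coord_eqI[OF B.basis_in[OF e] onb_in[OF onb e]])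
    show "(if i \<in> ?B then ip (B.basis e) i else 0) = (if i \<in> ?B then ip e i else 0)" for i
      using B.coord_basis[OF e, of i] onb_orthonormal[OF onb e, of i] e by auto
  qed
  then have eq: "((\<lambda>e. (cnorm ip (T e))\<^sup>2) has_sum s) ?B \<longleftrightarrow>
      ((\<lambda>e. (cnorm ip (T (B.basis e)))\<^sup>2) has_sum s) ?B"
    by (intro has_sum_cong) simp
  have me: "inner_coords K ip J \<Phi>" by (rule inner_coords_axioms)
  show ?thesis
    unfolding eq using hs_norm_basis_independent[OF me co T] hs_norm_basis_independent[OF co me T]
    by blast
qed

lemma HS_iff: "T \<in> HS K ip \<longleftrightarrow> bounded_op K ip T \<and> (\<forall>x. x \<notin> K \<longrightarrow> T x = 0) \<and>
    (\<lambda>j. (cnorm ip (T (basis j)))\<^sup>2) summable_on J"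
  unfolding HS_def summable_on_def using hs_norm_some_onb by blast

lemma HS_norm_has_sum:
  assumes T: "T \<in> HS K ip"
  shows "((\<lambda>j. (cnorm ip (T (basis j)))\<^sup>2) has_sum Re (HS_ip K ip T T)) J"
proof -
  have b: "bounded_op K ip T" using T by (simp add: HS_iff)
  obtain s where s: "((\<lambda>j. (cnorm ip (T (basis j)))\<^sup>2) has_sum s) J"
    using T by (auto simp: HS_iff summable_on_def)
  then have "((\<lambda>e. (cnorm ip (T e))\<^sup>2) has_sum s) (some_onb K ip)" using hs_norm_some_onb[OF b] by simp
  then have "((\<lambda>e. complex_of_real ((cnorm ip (T e))\<^sup>2)) has_sum of_real s) (some_onb K ip)"
    by (simp only: has_sum_of_real_iff)
  then have "((\<lambda>e. ip (T e) (T e)) has_sum of_real s) (some_onb K ip)"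
    by (rule has_sum_cong[THEN iffD1, rotated])
      (metis ip_self[OF inner_product_space] bounded_op_in[OF b]
        onb_in[OF onb_some_onb[OF inner_product_space]])
  then have "HS_ip K ip T T = of_real s" unfolding HS_ip_def by (rule infsumI)
  then show ?thesis using s by simp
qed

text \<open>Rows come first: left multiplication acts on \<open>j\<close>, right multiplication on
  \<open>k\<close>. For \<open>k\<close> outside \<open>J\<close> the vector \<open>basis k\<close>
  is unspecified, hence the explicit zero; for operators on \<open>K\<close>, rows outside
  \<open>J\<close> vanish already by \<open>coord_outside\<close>.\<close>

definition mat :: "('v \<Rightarrow> 'v) \<Rightarrow> 'i \<times> 'i \<Rightarrow> complex" where
  "mat T = (\<lambda>(j, k). if k \<in> J then \<Phi> (T (basis k)) j else 0)"

lemma csubspace_HS: "csubspace (HS K ip)"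
  unfolding csubspace_def
proof (intro conjI ballI allI)
  show "0 \<in> HS K ip"
    by (auto simp: HS_iff norm_zero csubspace_zero[OF csubspace] clinear_on_def
        intro!: bounded_opI[of 0])
  fix S assume S: "S \<in> HS K ip"
  then have Sb: "bounded_op K ip S" by (simp add: HS_iff)
  show "S + T \<in> HS K ip" if T: "T \<in> HS K ip" for T
  proof -
    have Tb: "bounded_op K ip T" using T by (simp add: HS_iff)
    have "(\<lambda>j. 2 * (cnorm ip (S (basis j)))\<^sup>2 + 2 * (cnorm ip (T (basis j)))\<^sup>2) summable_on J"
      using S T by (intro summable_on_add summable_on_cmult_right) (auto simp: HS_iff)
    then have "(\<lambda>j. (cnorm ip ((S + T) (basis j)))\<^sup>2) summable_on J"
      by (rule summable_on_real_comparison)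
        (simp_all add: norm_add_square_le bounded_op_in[OF Sb] bounded_op_in[OF Tb] basis_in)
    then show ?thesis using S T by (auto simp: HS_iff bounded_op_add)
  qed
  fix c
  have "(\<lambda>j. (cmod c)\<^sup>2 * (cnorm ip (S (basis j)))\<^sup>2) summable_on J"
    using S by (intro summable_on_cmult_right) (auto simp: HS_iff)
  then have "(\<lambda>j. (cnorm ip ((c *\<^sub>C S) (basis j)))\<^sup>2) summable_on J"
    by (rule summable_on_cong[THEN iffD1, rotated])
      (simp add: scaleC_fun_def norm_scale bounded_op_in[OF Sb] basis_in power_mult_distrib)
  then show "c *\<^sub>C S \<in> HS K ip"
    using S bounded_op_scale[OF Sb] by (auto simp: HS_iff scaleC_fun_def)
qed

text \<open>The rows of a square-summable matrix are vectors by which its operator is defined.\<close>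

lemma mat_surj:
  assumes a: "a \<in> sqsum (J \<times> J)" shows "\<exists>T\<in>HS K ip. mat T = a"
proof -
  note V = inner_product_space
  have S: "(\<lambda>p. (cmod (a p))\<^sup>2) summable_on (J \<times> J)" using a by (simp add: sqsum_def)
  then obtain s where s: "((\<lambda>p. (cmod (a p))\<^sup>2) has_sum s) (J \<times> J)" by (auto simp: summable_on_def)
  \<comment> \<open>Conjugated, so that the inner product of \<open>x\<close> with row vector
    \<open>j\<close> is the \<open>j\<close>-th entry of the matrix product.\<close>
  define r where "r j = (\<lambda>k. cnj (a (j, k)))" for j
  have r: "r j \<in> sqsum J" if "j \<in> J" for j
    using a summable_on_SigmaD1[of "\<lambda>n h. (cmod (a (n, h)))\<^sup>2" J "\<lambda>_. J" j] S that
    by (simp add: sqsum_def case_prod_unfold r_def)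
  define w where "w j = vec (r j)" for j
  have w: "w j \<in> K" and wc: "\<Phi> (w j) k = cnj (a (j, k))" if "j \<in> J" for j k
    using vec_in[OF r[OF that]] coord_vec[OF r[OF that]] by (auto simp: w_def r_def)
  have rows: "((\<lambda>j. (cnorm ip (w j))\<^sup>2) has_sum s) J"
    using s by (rule has_sum_SigmaD) (use norm_has_sum[OF w] in \<open>simp add: wc\<close>)
  have s0: "s \<ge> 0" by (rule has_sum_nonneg[OF rows]) simp
  define c where "c x = (\<lambda>j. if j \<in> J then ip x (w j) else 0)" for x
  have c_le: "(cmod (c x j))\<^sup>2 \<le> (cnorm ip (w j))\<^sup>2 * (cnorm ip x)\<^sup>2" if "x \<in> K" "j \<in> J" for x j
    using power_mono[OF ip_Cauchy_Schwarz[OF V that(1) w[OF that(2)]], of 2] that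
    by (simp add: c_def power_mult_distrib mult.commute)
  \<comment> \<open>Summing the Cauchy--Schwarz bounds over the rows shows at once that images are
    square-summable and that \<open>s\<close> bounds the squared operator norm.\<close>
  have hs: "((\<lambda>j. (cnorm ip (w j))\<^sup>2 * (cnorm ip x)\<^sup>2) has_sum s * (cnorm ip x)\<^sup>2) J" for x
    by (rule has_sum_cmult_left[OF rows])
  have c: "c x \<in> sqsum J" if x: "x \<in> K" for x
  proof -
    have "(\<lambda>j. (cmod (c x j))\<^sup>2) summable_on J"
      by (rule summable_on_real_comparison[OF has_sum_imp_summable[OF hs[of x]]]) (simp_all add: c_le x)
    then show ?thesis by (simp add: sqsum_def c_def)
  qed
  define T where "T x = (if x \<in> K then vec (c x) else 0)" for x
  have TK: "T x \<in> K" and Tc: "\<Phi> (T x) j = c x j" if "x \<in> K" for x j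
    using that vec_in[OF c] coord_vec[OF c] by (auto simp: T_def)
  have b: "bounded_op K ip T"
  proof (rule bounded_opI[OF s0 TK])
    show "clinear_on K T"
      unfolding clinear_on_def
    proof (intro conjI ballI allI)
      fix x assume x: "x \<in> K"
      show "T (x + y) = T x + T y" if y: "y \<in> K" for y
        using csubspace_add[OF csubspace x y]
        by (intro coord_eqI TK csubspace_add[OF csubspace])
          (simp_all add: x y Tc coord_add TK c_def ip_add_left[OF V] w)
      show "T (d *\<^sub>C x) = d *\<^sub>C T x" for d
        using csubspace_scale[OF csubspace x]
        by (intro coord_eqI TK csubspace_scale[OF csubspace])
          (simp_all add: x Tc coord_scale TK c_def ip_scale_left[OF V] w)
    qed
    show "(cnorm ip (T x))\<^sup>2 \<le> s * (cnorm ip x)\<^sup>2" if x: "x \<in> K" for x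
      by (rule has_sum_mono[OF norm_has_sum[OF TK[OF x]] hs]) (simp add: Tc x c_le)
  qed
  have Tb: "\<Phi> (T (basis k)) j = a (j, k)" if "j \<in> J" "k \<in> J" for j k
    using that ip_commute[OF V w[OF that(1)] basis_in[OF that(2)]]
    by (simp add: Tc basis_in c_def ip_basis w wc)
  have "((\<lambda>(k, j). (cmod (a (j, k)))\<^sup>2) has_sum s) (J \<times> J)" using s by (rule has_sum_swap[THEN iffD1])
  then have "((\<lambda>k. (cnorm ip (T (basis k)))\<^sup>2) has_sum s) J"
  proof (rule has_sum_SigmaD)
    fix k assume k: "k \<in> J"
    show "((\<lambda>j. case (k, j) of (k, j) \<Rightarrow> (cmod (a (j, k)))\<^sup>2) has_sum (cnorm ip (T (basis k)))\<^sup>2) J"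
      using norm_has_sum[OF TK[OF basis_in[OF k]]]
      by (rule has_sum_cong[THEN iffD1, rotated]) (simp add: Tb k)
  qed
  then have "T \<in> HS K ip" using b by (auto simp: HS_iff T_def summable_on_def)
  moreover have "mat T = a"
  proof
    fix p :: "'i \<times> 'i"
    obtain j k where p: "p = (j, k)" by (cases p)
    show "mat T p = a p"
    proof (cases "j \<in> J \<and> k \<in> J")
      case False
      then have "a p = 0" using a by (simp add: sqsum_def p)
      then show ?thesis using False coord_outside[OF TK[OF basis_in]] by (auto simp: mat_def p)
    qed (simp add: mat_def p Tb)
  qed
  ultimately show ?thesis by blast
qed

text \<open>Column norms add up to the sum over all entries, by Fubini. Injectivity combines
  determination by basis values on \<open>K\<close> with the convention that members of
  \<open>HS\<close> vanish elsewhere.\<close>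

theorem HS_l2_coords: "l2_coords (HS K ip) (HS_ip K ip) (J \<times> J) mat"
proof
  have HSb: "bounded_op K ip T" if "T \<in> HS K ip" for T using that by (simp add: HS_iff)
  show "csubspace (HS K ip)" by (rule csubspace_HS)
  show "clinear_on (HS K ip) mat"
    unfolding clinear_on_def mat_def
    by (auto simp: fun_eq_iff scaleC_fun_def scaleC_complex_def coord_add coord_scale
        bounded_op_in[OF HSb] basis_in)
  show square: "((\<lambda>i. (cmod (mat T i))\<^sup>2) has_sum Re (HS_ip K ip T T)) (J \<times> J)" if T: "T \<in> HS K ip" for T
  proof -
    let ?f = "\<lambda>(k, j). (cmod (mat T (j, k)))\<^sup>2"
    note n = HS_norm_has_sum[OF T]
    have sec: "((\<lambda>j. ?f (k, j)) has_sum (cnorm ip (T (basis k)))\<^sup>2) J" if "k \<in> J" for k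
      using norm_has_sum[OF bounded_op_in[OF HSb[OF T] basis_in[OF that]]] that by (simp add: mat_def)
    have "?f summable_on J \<times> J"
      by (rule summable_on_SigmaI[OF sec]) (use n in \<open>auto simp: summable_on_def\<close>)
    with sec n have "(?f has_sum Re (HS_ip K ip T T)) (J \<times> J)" by (rule has_sum_SigmaI)
    then show ?thesis by (subst has_sum_swap) simp
  qed
  show "bij_betw mat (HS K ip) (sqsum (J \<times> J))"
    unfolding bij_betw_def
  proof
    show "inj_on mat (HS K ip)"
    proof (rule inj_onI)
      fix S T assume S: "S \<in> HS K ip" and T: "T \<in> HS K ip" and eq: "mat S = mat T"
      have "S (basis k) = T (basis k)" if k: "k \<in> J" for k
      proof (rule coord_eqI[OF bounded_op_in[OF HSb[OF S] basis_in[OF k]] bounded_op_in[OF HSb[OF T] basis_in[OF k]]])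
        show "\<Phi> (S (basis k)) j = \<Phi> (T (basis k)) j" for j
          using fun_cong[OF eq, of "(j, k)"] k by (simp add: mat_def)
      qed
      from bounded_op_basis_eq[OF HSb[OF S] HSb[OF T] this] have "S x = T x" if "x \<in> K" for x
        using that by blast
      moreover have "S x = T x" if "x \<notin> K" for x using S T that by (simp add: HS_iff)
      ultimately show "S = T" by blast
    qed
    have "mat T \<in> sqsum (J \<times> J)" if T: "T \<in> HS K ip" for T
      using square[OF T] coord_outside[OF bounded_op_in[OF HSb[OF T] basis_in]]
      by (auto simp: sqsum_def mat_def summable_on_def)
    then show "mat ` HS K ip = sqsum (J \<times> J)" using mat_surj by blast
  qed
qed

end

section \<open>Operators that permute coordinates\<close>

context l2_coords
begin

lemma bounded_op_compose:
  assumes S: "bounded_op E ip S" and T: "bounded_op E ip T" shows "bounded_op E ip (\<lambda>x. S (T x))"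
proof -
  obtain B where B: "B > 0" "\<And>x. x \<in> E \<Longrightarrow> cnorm ip (S x) \<le> B * cnorm ip x"
    by (rule bounded_opE[OF S]) blast
  obtain C where C: "C > 0" "\<And>x. x \<in> E \<Longrightarrow> cnorm ip (T x) \<le> C * cnorm ip x"
    by (rule bounded_opE[OF T]) blast
  have "clinear_on E (\<lambda>x. S (T x))"
    using bounded_op_clinear[OF S] bounded_op_clinear[OF T] bounded_op_in[OF T]
    by (auto simp: clinear_on_def)
  moreover have "cnorm ip (S (T x)) \<le> (B * C) * cnorm ip x" if x: "x \<in> E" for x
  proof -
    have "cnorm ip (S (T x)) \<le> B * cnorm ip (T x)" by (rule B(2)[OF bounded_op_in[OF T x]])
    also have "\<dots> \<le> B * (C * cnorm ip x)" by (rule mult_left_mono[OF C(2)[OF x]]) (use B in simp)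
    finally show ?thesis by (simp add: mult.assoc)
  qed
  ultimately show ?thesis
    unfolding bounded_op_def using bounded_op_in[OF S] bounded_op_in[OF T] by blast
qed

lemma bounded_op_cong:
  assumes "bounded_op E ip S" "\<And>x. x \<in> E \<Longrightarrow> S x = T x" shows "bounded_op E ip T"
  using assms csubspace_add[OF csubspace] csubspace_scale[OF csubspace]
  unfolding bounded_op_def clinear_on_def by simp

text \<open>Coordinates are pulled back: in coordinates, \<open>U\<close> is the adjoint of the
  isometry sending basis vector \<open>i\<close> to basis vector \<open>\<tau> i\<close>. Hence a
  backward shift corresponds to raising an index, and coordinates of \<open>x\<close> outside the
  image of \<open>\<tau>\<close> are forgotten.\<close>

definition acts_as :: "('v \<Rightarrow> 'v) \<Rightarrow> ('i \<Rightarrow> 'i) \<Rightarrow> bool" where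
  "acts_as U \<tau> \<longleftrightarrow> inj_on \<tau> J \<and> \<tau> ` J \<subseteq> J \<and> (\<forall>x\<in>E. U x \<in> E \<and> (\<forall>i\<in>J. \<Phi> (U x) i = \<Phi> x (\<tau> i)))"

text \<open>Injectivity of \<open>\<tau>\<close> lets each squared coordinate of \<open>x\<close>
  occur at most once, so \<open>U\<close> is a contraction.\<close>

lemma acts_as_bounded:
  assumes "acts_as U \<tau>" shows "bounded_op E ip U"
proof (rule bounded_opI)
  have inj: "inj_on \<tau> J" and \<tau>: "\<tau> ` J \<subseteq> J" and U: "\<And>x. x \<in> E \<Longrightarrow> U x \<in> E"
    and c: "\<And>x i. x \<in> E \<Longrightarrow> i \<in> J \<Longrightarrow> \<Phi> (U x) i = \<Phi> x (\<tau> i)"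
    using assms by (auto simp: acts_as_def)
  show "U x \<in> E" if "x \<in> E" for x using U[OF that] .
  show "clinear_on E U"
    unfolding clinear_on_def
  proof (intro conjI ballI allI)
    fix x assume x: "x \<in> E"
    show "U (x + y) = U x + U y" if y: "y \<in> E" for y
      using csubspace_add[OF csubspace x y] csubspace_add[OF csubspace U[OF x] U[OF y]]
      by (intro coord_eqI) (simp_all add: U c coord_add x y)
    show "U (d *\<^sub>C x) = d *\<^sub>C U x" for d
      using csubspace_scale[OF csubspace x] csubspace_scale[OF csubspace U[OF x]]
      by (intro coord_eqI) (simp_all add: U c coord_scale x)
  qed
  show "(cnorm ip (U x))\<^sup>2 \<le> 1 * (cnorm ip x)\<^sup>2" if x: "x \<in> E" for x
  proof (rule has_sum_le_finite_sums[OF norm_has_sum[OF U[OF x]]])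
    fix F assume F: "finite F" "F \<subseteq> J"
    have "(\<Sum>i\<in>F. (cmod (\<Phi> (U x) i))\<^sup>2) = (\<Sum>i\<in>\<tau> ` F. (cmod (\<Phi> x i))\<^sup>2)"
      using F by (subst sum.reindex[OF inj_on_subset[OF inj F(2)]]) (auto simp: c[OF x] intro!: sum.cong)
    also have "\<dots> \<le> 1 * (cnorm ip x)\<^sup>2"
      using F \<tau> finite_sum_le_has_sum[OF norm_has_sum[OF x], of "\<tau> ` F"] by force
    finally show "(\<Sum>i\<in>F. (cmod (\<Phi> (U x) i))\<^sup>2) \<le> 1 * (cnorm ip x)\<^sup>2" .
  qed
qed simp

text \<open>Supplies the left inverse of an embedding, which reads back the coordinates stored along
  an injection.\<close>

lemma acts_as_exists:
  assumes inj: "inj_on \<tau> J" and \<tau>: "\<tau> ` J \<subseteq> J" shows "\<exists>P. acts_as P \<tau>"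
proof -
  define a where "a x = (\<lambda>i. if i \<in> J then \<Phi> x (\<tau> i) else 0)" for x
  have a: "a x \<in> sqsum J" if x: "x \<in> E" for x
  proof (rule sqsum_boundedI)
    fix F assume F: "finite F" "F \<subseteq> J"
    have "(\<Sum>i\<in>F. (cmod (a x i))\<^sup>2) = (\<Sum>i\<in>\<tau> ` F. (cmod (\<Phi> x i))\<^sup>2)"
      using F by (subst sum.reindex[OF inj_on_subset[OF inj F(2)]]) (auto simp: a_def intro!: sum.cong)
    also have "\<dots> \<le> (cnorm ip x)\<^sup>2"
      using F \<tau> by (intro finite_sum_le_has_sum[OF norm_has_sum[OF x]]) auto
    finally show "(\<Sum>i\<in>F. (cmod (a x i))\<^sup>2) \<le> (cnorm ip x)\<^sup>2" .
  qed (simp add: a_def)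
  have "acts_as (\<lambda>x. vec (a x)) \<tau>"
    unfolding acts_as_def using inj \<tau> by (simp add: vec_in a coord_vec) (simp add: a_def)
  then show ?thesis by blast
qed

text \<open>The range of \<open>V\<close> is the set of fixed points of the continuous map \<open>V \<circ> P\<close>, hence closed.\<close>

lemma left_invertible_embedding:
  assumes V: "bounded_op E ip V" and P: "bounded_op E ip P" and PV: "\<And>x. x \<in> E \<Longrightarrow> P (V x) = x"
  shows "closed_subspace E ip (V ` E)" and "lin_iso ip E (V ` E) V"
    and "lin_iso ip (V ` E) E (inv_into E V)"
proof -
  note VE = bounded_op_in[OF V] and PE = bounded_op_in[OF P]
  note V_add = clinear_on_add[OF bounded_op_clinear[OF V]]
    and V_scale = clinear_on_scale[OF bounded_op_clinear[OF V]]
  obtain B where B: "B > 0" "\<And>x. x \<in> E \<Longrightarrow> cnorm ip (V x) \<le> B * cnorm ip x"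
    by (rule bounded_opE[OF V]) blast
  obtain C where C: "C > 0" "\<And>x. x \<in> E \<Longrightarrow> cnorm ip (P x) \<le> C * cnorm ip x"
    by (rule bounded_opE[OF P]) blast
  have inj: "inj_on V E" by (rule inj_on_inverseI) (rule PV)
  have below: "cnorm ip x \<le> C * cnorm ip (V x)" if "x \<in> E" for x
    using C(2)[OF VE[OF that]] PV[OF that] by simp
  show "closed_subspace E ip (V ` E)"
    unfolding closed_subspace_def
  proof (intro conjI allI ballI impI)
    show "V ` E \<subseteq> E" using VE by blast
    show "csubspace (V ` E)"
      unfolding csubspace_def
    proof (intro conjI ballI allI)
      show "0 \<in> V ` E"
        using clinear_on_zero[OF bounded_op_clinear[OF V] csubspace] csubspace_zero[OF csubspace]
        by (metis image_eqI)
      fix y assume "y \<in> V ` E"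
      then obtain x where x: "x \<in> E" "y = V x" by blast
      show "c *\<^sub>C y \<in> V ` E" for c
        using V_scale[OF x(1), of c] csubspace_scale[OF csubspace x(1)] x(2) by (metis image_eqI)
      fix z assume "z \<in> V ` E"
      then obtain x' where x': "x' \<in> E" "z = V x'" by blast
      show "y + z \<in> V ` E"
        using V_add[OF x(1) x'(1)] csubspace_add[OF csubspace x(1) x'(1)] x x' by (metis image_eqI)
    qed
    fix s :: "nat \<Rightarrow> 'v" and l
    assume l: "l \<in> E" and s: "range s \<subseteq> V ` E" and lim: "(\<lambda>n. cnorm ip (s n - l)) \<longlonglongrightarrow> 0"
    note VP = bounded_op_compose[OF V P]
    obtain D where D: "D > 0" "\<And>x. x \<in> E \<Longrightarrow> cnorm ip (V (P x)) \<le> D * cnorm ip x"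
      by (rule bounded_opE[OF VP]) blast
    have "\<exists>x\<in>E. s n = V x" for n using s by blast
    then have sE: "s n \<in> E" and sV: "V (P (s n)) = s n" for n using VE PV by metis+
    have d: "s n - l \<in> E" for n by (rule csubspace_diff[OF csubspace sE l])
    \<comment> \<open>Used twice: for \<open>y = V (P l)\<close> with the bound \<open>D\<close> of
      the composite of \<open>V\<close> and \<open>P\<close>, and for \<open>y = l\<close> with
      constant 1. Uniqueness of limits then makes \<open>l\<close> a fixed point.\<close>
    have lim': "(\<lambda>n. \<Phi> (s n) i) \<longlonglongrightarrow> \<Phi> y i"
      if y: "y \<in> E" and le: "\<And>n. cnorm ip (s n - y) \<le> D' * cnorm ip (s n - l)" for y D' i
    proof (rule LIM_zero_cancel)
      have g: "(\<lambda>n. D' * cnorm ip (s n - l)) \<longlonglongrightarrow> 0" using tendsto_mult_left[OF lim, of D'] by simp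
      show "(\<lambda>n. \<Phi> (s n) i - \<Phi> y i) \<longlonglongrightarrow> 0"
      proof (rule Lim_null_comparison[OF always_eventually g], rule allI)
        fix n
        show "norm (\<Phi> (s n) i - \<Phi> y i) \<le> D' * cnorm ip (s n - l)"
          using coord_le_norm[OF csubspace_diff[OF csubspace sE y], of n i] le[of n]
          by (simp add: coord_diff sE y)
      qed
    qed
    have "V (P l) = l"
    proof (rule coord_eqI[OF VE[OF PE[OF l]] l])
      fix i
      have "cnorm ip (s n - V (P l)) \<le> D * cnorm ip (s n - l)" for n
        using D(2)[OF d, of n] clinear_on_diff[OF bounded_op_clinear[OF VP] csubspace sE l, of n] sV by simp
      from LIMSEQ_unique[OF lim'[OF VE[OF PE[OF l]] this] lim'[OF l, of 1]]
      show "\<Phi> (V (P l)) i = \<Phi> l i" by simp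
    qed
    then show "l \<in> V ` E" using PE[OF l] by (metis image_eqI)
  qed
  show "lin_iso ip E (V ` E) V"
    unfolding lin_iso_def using bounded_op_clinear[OF V] inj B(2) below
    by (auto simp: bij_betw_def)
  have inv: "inv_into E V (V x) = x" if "x \<in> E" for x using inv_into_f_f[OF inj that] .
  have "clinear_on (V ` E) (inv_into E V)"
    unfolding clinear_on_def
    using inv csubspace_add[OF csubspace] csubspace_scale[OF csubspace]
    by (auto simp: V_add[symmetric] V_scale[symmetric])
  then show "lin_iso ip (V ` E) E (inv_into E V)"
    unfolding lin_iso_def using inj_on_imp_bij_betw[OF inj, THEN bij_betw_inv_into] below B(2)
    by (auto simp: inv)
qed

text \<open>Stores the whole family of vectors \<open>A g x\<close> in the single vector
  \<open>V x\<close>: coordinate \<open>i\<close> of copy \<open>g\<close> is written at position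
  \<open>\<psi> (g, i)\<close>, zeros elsewhere. The sum of the weights \<open>w\<close> bounds
  \<open>V\<close>; the copy \<open>g0\<close>, on which the family is the identity, gives the left
  inverse. Keeping the type of \<open>g\<close> free covers one operator (\<open>nat\<close>) and
  two (\<open>nat \<times> nat\<close>).\<close>

lemma dilation_exists:
  fixes A :: "'g \<Rightarrow> 'v \<Rightarrow> 'v" and \<psi> :: "'g \<times> 'i \<Rightarrow> 'i"
  assumes A: "\<And>g. clinear_on E (A g)" "\<And>g x. x \<in> E \<Longrightarrow> A g x \<in> E"
    and w: "\<And>g x. x \<in> E \<Longrightarrow> (cnorm ip (A g x))\<^sup>2 \<le> w g * (cnorm ip x)\<^sup>2" "w summable_on UNIV" "\<And>g. w g \<ge> 0"
    and \<psi>: "inj_on \<psi> (UNIV \<times> J)" "\<psi> ` (UNIV \<times> J) \<subseteq> J"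
    and g0: "\<And>x. x \<in> E \<Longrightarrow> A g0 x = x"
  obtains V where "closed_subspace E ip (V ` E)" "lin_iso ip E (V ` E) V"
    "lin_iso ip (V ` E) E (inv_into E V)" "bounded_op E ip V" "inj_on V E"
    "\<And>x g i. x \<in> E \<Longrightarrow> i \<in> J \<Longrightarrow> \<Phi> (V x) (\<psi> (g, i)) = \<Phi> (A g x) i"
    "\<And>x j. x \<in> E \<Longrightarrow> j \<notin> \<psi> ` (UNIV \<times> J) \<Longrightarrow> \<Phi> (V x) j = 0"
proof -
  define a where "a x j = (if j \<in> \<psi> ` (UNIV \<times> J) then
    (case inv_into (UNIV \<times> J) \<psi> j of (g, i) \<Rightarrow> \<Phi> (A g x) i) else 0)" for x j
  have a\<psi>: "a x (\<psi> (g, i)) = \<Phi> (A g x) i" if "i \<in> J" for x g i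
    using that inv_into_f_f[OF \<psi>(1), of "(g, i)"] by (auto simp: a_def)
  have a0: "a x j = 0" if "j \<notin> \<psi> ` (UNIV \<times> J)" for x j using that by (simp add: a_def)
  obtain W where W: "(w has_sum W) UNIV" using w(2) by (auto simp: summable_on_def)
  have hs: "\<exists>t. ((\<lambda>j. (cmod (a x j))\<^sup>2) has_sum t) J \<and> t \<le> W * (cnorm ip x)\<^sup>2" if x: "x \<in> E" for x
  proof -
    note hW = has_sum_cmult_left[OF W, of "(cnorm ip x)\<^sup>2"]
    have "(\<lambda>g. (cnorm ip (A g x))\<^sup>2) summable_on UNIV"
      by (rule summable_on_real_comparison[OF has_sum_imp_summable[OF hW]]) (simp_all add: w(1) x)
    then obtain t where t: "((\<lambda>g. (cnorm ip (A g x))\<^sup>2) has_sum t) UNIV" by (auto simp: summable_on_def)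
    let ?f = "\<lambda>(g, i). (cmod (\<Phi> (A g x) i))\<^sup>2"
    have sec: "((\<lambda>i. ?f (g, i)) has_sum (cnorm ip (A g x))\<^sup>2) J" if "g \<in> UNIV" for g
      using norm_has_sum[OF A(2)[OF x]] by simp
    have "?f summable_on UNIV \<times> J"
      by (rule summable_on_SigmaI[OF sec]) (use t in \<open>auto simp: summable_on_def\<close>)
    with sec t have "(?f has_sum t) (UNIV \<times> J)" by (rule has_sum_SigmaI)
    then have "(((\<lambda>j. (cmod (a x j))\<^sup>2) \<circ> \<psi>) has_sum t) (UNIV \<times> J)"
      by (rule has_sum_cong[THEN iffD1, rotated]) (auto simp: a\<psi>)
    then have "((\<lambda>j. (cmod (a x j))\<^sup>2) has_sum t) (\<psi> ` (UNIV \<times> J))"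
      using has_sum_reindex[OF \<psi>(1)] by blast
    then have "((\<lambda>j. (cmod (a x j))\<^sup>2) has_sum t) J"
      by (rule has_sum_cong_neutral[THEN iffD1, rotated -1]) (use \<psi>(2) a0 in auto)
    moreover have "t \<le> W * (cnorm ip x)\<^sup>2" by (rule has_sum_mono[OF t hW]) (rule w(1)[OF x])
    ultimately show ?thesis by blast
  qed
  have aJ: "a x \<in> sqsum J" if x: "x \<in> E" for x
    using hs[OF x] a0[of _ x] \<psi>(2) by (auto simp: sqsum_def summable_on_def)
  define V where "V x = vec (a x)" for x
  have VE: "V x \<in> E" and Vc: "\<Phi> (V x) j = a x j" if "x \<in> E" for x j
    using vec_in[OF aJ[OF that]] coord_vec[OF aJ[OF that]] by (auto simp: V_def)
  have V: "bounded_op E ip V"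
  proof (rule bounded_opI[OF _ VE])
    show "W \<ge> 0" by (rule has_sum_nonneg[OF W]) (rule w(3))
    show "clinear_on E V"
      unfolding clinear_on_def
    proof (intro conjI ballI allI)
      fix x assume x: "x \<in> E"
      show "V (x + y) = V x + V y" if y: "y \<in> E" for y
        using csubspace_add[OF csubspace x y] csubspace_add[OF csubspace VE[OF x] VE[OF y]]
        by (intro coord_eqI)
          (auto simp: VE Vc coord_add x y a_def clinear_on_add[OF A(1)] A(2) split: prod.splits)
      show "V (d *\<^sub>C x) = d *\<^sub>C V x" for d
        using csubspace_scale[OF csubspace x] csubspace_scale[OF csubspace VE[OF x]]
        by (intro coord_eqI)
          (auto simp: VE Vc coord_scale x a_def clinear_on_scale[OF A(1)] A(2) split: prod.splits)
    qed
    show "(cnorm ip (V x))\<^sup>2 \<le> W * (cnorm ip x)\<^sup>2" if x: "x \<in> E" for x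
    proof -
      obtain t where t: "((\<lambda>j. (cmod (a x j))\<^sup>2) has_sum t) J" "t \<le> W * (cnorm ip x)\<^sup>2"
        using hs[OF x] by blast
      have "((\<lambda>j. (cmod (\<Phi> (V x) j))\<^sup>2) has_sum t) J" using t(1) by (simp add: Vc x)
      from has_sum_unique[OF norm_has_sum[OF VE[OF x]] this] show ?thesis using t(2) by simp
    qed
  qed
  have "inj_on (\<lambda>i. \<psi> (g0, i)) J" using \<psi>(1) by (auto simp: inj_on_def)
  moreover have "(\<lambda>i. \<psi> (g0, i)) ` J \<subseteq> J" using \<psi>(2) by auto
  ultimately obtain P where P: "acts_as P (\<lambda>i. \<psi> (g0, i))" using acts_as_exists by blast
  have PV: "P (V x) = x" if x: "x \<in> E" for x
  proof (rule coord_eqI[OF _ x])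
    show "P (V x) \<in> E" using P VE[OF x] by (simp add: acts_as_def)
    show "\<Phi> (P (V x)) i = \<Phi> x i" if "i \<in> J" for i
      using P VE[OF x] that by (simp add: acts_as_def Vc x a\<psi> g0)
  qed
  note emb = left_invertible_embedding[OF V acts_as_bounded[OF P] PV]
  have inj: "inj_on V E" by (rule inj_on_inverseI) (rule PV)
  show thesis
    by (rule that[OF emb V inj]) (simp_all add: Vc a\<psi> a0)
qed

section \<open>Powers of small operators and their intertwining with shifts\<close>

lemma funpow_half:
  assumes S: "bounded_op E ip S" and half: "\<And>x. x \<in> E \<Longrightarrow> cnorm ip (S x) \<le> cnorm ip x / 2" and x: "x \<in> E"
  shows "(S ^^ n) x \<in> E" and "(cnorm ip ((S ^^ n) x))\<^sup>2 \<le> (1 / 4) ^ n * (cnorm ip x)\<^sup>2"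
proof -
  have "(S ^^ n) x \<in> E \<and> (cnorm ip ((S ^^ n) x))\<^sup>2 \<le> (1 / 4) ^ n * (cnorm ip x)\<^sup>2"
  proof (induction n)
    case (Suc n)
    then have y: "(S ^^ n) x \<in> E" by blast
    have "(cnorm ip (S ((S ^^ n) x)))\<^sup>2 \<le> (cnorm ip ((S ^^ n) x) / 2)\<^sup>2"
      by (intro power_mono half y norm_nonneg bounded_op_in[OF S])
    then show ?case using Suc bounded_op_in[OF S y] by (simp add: power_divide)
  qed (simp add: x)
  then show "(S ^^ n) x \<in> E" and "(cnorm ip ((S ^^ n) x))\<^sup>2 \<le> (1 / 4) ^ n * (cnorm ip x)\<^sup>2" by auto
qed

lemma clinear_on_funpow:
  assumes "bounded_op E ip S" shows "clinear_on E (S ^^ n)"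
proof -
  have "bounded_op E ip (S ^^ n)"
  proof (induction n)
    case 0
    show ?case by (rule bounded_opI[of 1]) (auto simp: clinear_on_def)
  next
    case (Suc n)
    show ?case using bounded_op_compose[OF assms Suc] by (simp add: comp_def)
  qed
  then show ?thesis by (rule bounded_op_clinear)
qed

text \<open>All scalars up to a threshold are allowed, because a commuting pair has to be scaled by
  one common \<open>c\<close>.\<close>

lemma scale_to_half:
  assumes T: "bounded_op E ip T"
  shows "\<exists>C>0. \<forall>c. cmod c \<le> 1 / C \<longrightarrow> (\<forall>x\<in>E. cnorm ip ((c *\<^sub>C T) x) \<le> cnorm ip x / 2)"
proof -
  obtain C where C: "C > 0" "\<And>x. x \<in> E \<Longrightarrow> cnorm ip (T x) \<le> C * cnorm ip x"
    by (rule bounded_opE[OF T]) blast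
  have "cnorm ip ((c *\<^sub>C T) x) \<le> cnorm ip x / 2" if c: "cmod c \<le> 1 / (2 * C)" and x: "x \<in> E" for c x
  proof -
    have "cnorm ip ((c *\<^sub>C T) x) = cmod c * cnorm ip (T x)"
      by (simp add: scaleC_fun_def norm_scale bounded_op_in[OF T x])
    also have "\<dots> \<le> 1 / (2 * C) * (C * cnorm ip x)"
      by (intro mult_mono c C(2) x norm_nonneg bounded_op_in[OF T x]) (use C in auto)
    also have "\<dots> = cnorm ip x / 2" using C(1) by simp
    finally show ?thesis .
  qed
  then show ?thesis using C(1) by (intro exI[of _ "2 * C"]) auto
qed

text \<open>On positions in a copy, \<open>U\<close> reads the next copy, which for \<open>A\<close>
  means applying \<open>S\<close> first. Elsewhere \<open>V (S x)\<close> is zero, and the second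
  condition on \<open>\<tau>\<close> keeps \<open>U\<close> from reading a stored value
  there.\<close>

lemma shift_intertwines:
  assumes U: "acts_as U \<tau>" and S: "\<And>x. x \<in> E \<Longrightarrow> S x \<in> E"
    and V: "\<And>x. x \<in> E \<Longrightarrow> V x \<in> E"
      "\<And>x g i. x \<in> E \<Longrightarrow> i \<in> J \<Longrightarrow> \<Phi> (V x) (\<psi> (g, i)) = \<Phi> (A g x) i"
      "\<And>x j. x \<in> E \<Longrightarrow> j \<notin> \<psi> ` (UNIV \<times> J) \<Longrightarrow> \<Phi> (V x) j = 0"
    and \<tau>: "\<And>g i. i \<in> J \<Longrightarrow> \<tau> (\<psi> (g, i)) = \<psi> (\<sigma> g, i)"
      "\<And>j. j \<in> J \<Longrightarrow> \<tau> j \<in> \<psi> ` (UNIV \<times> J) \<Longrightarrow> j \<in> \<psi> ` (UNIV \<times> J)"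
    and A: "\<And>x g. x \<in> E \<Longrightarrow> A (\<sigma> g) x = A g (S x)" and x: "x \<in> E"
  shows "U (V x) = V (S x)"
proof (rule coord_eqI)
  show "U (V x) \<in> E" using U V(1)[OF x] by (simp add: acts_as_def)
  show "V (S x) \<in> E" using V(1)[OF S[OF x]] .
  fix j assume j: "j \<in> J"
  have "\<Phi> (U (V x)) j = \<Phi> (V x) (\<tau> j)" using U V(1)[OF x] j by (simp add: acts_as_def)
  also have "\<dots> = \<Phi> (V (S x)) j"
  proof (cases "j \<in> \<psi> ` (UNIV \<times> J)")
    case True
    then obtain g i where "i \<in> J" "j = \<psi> (g, i)" by auto
    then show ?thesis by (simp add: \<tau>(1) V(2) x S A)
  next
    case False
    then have "\<tau> j \<notin> \<psi> ` (UNIV \<times> J)" using \<tau>(2)[OF j] by blast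
    then show ?thesis using False by (simp add: V(3) x S)
  qed
  finally show "\<Phi> (U (V x)) j = \<Phi> (V (S x)) j" .
qed

text \<open>The embedding is \<open>x \<mapsto> (x, S x, S\<^sup>2 x, \<dots>)\<close>, where \<open>S\<close> is a multiple of \<open>T\<close> of norm at most \<open>1/2\<close>.\<close>

theorem shift_universal:
  fixes \<psi> :: "nat \<times> 'i \<Rightarrow> 'i"
  assumes U: "acts_as U \<tau>" and \<psi>: "inj_on \<psi> (UNIV \<times> J)" "\<psi> ` (UNIV \<times> J) \<subseteq> J"
    and \<tau>: "\<And>n i. i \<in> J \<Longrightarrow> \<tau> (\<psi> (n, i)) = \<psi> (Suc n, i)"
      "\<And>j. j \<in> J \<Longrightarrow> \<tau> j \<in> \<psi> ` (UNIV \<times> J) \<Longrightarrow> j \<in> \<psi> ` (UNIV \<times> J)"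
  shows "universal_op E ip U"
  unfolding universal_op_def
proof (intro conjI allI impI)
  show "bounded_op E ip U" by (rule acts_as_bounded[OF U])
  fix T assume T: "bounded_op E ip T"
  obtain C where C: "C > 0"
    "\<And>c x. cmod c \<le> 1 / C \<Longrightarrow> x \<in> E \<Longrightarrow> cnorm ip ((c *\<^sub>C T) x) \<le> cnorm ip x / 2"
    using scale_to_half[OF T] by blast
  define c where "c = complex_of_real (1 / C)"
  define S where "S = c *\<^sub>C T"
  have c: "c \<noteq> 0" "cmod c \<le> 1 / C" using C(1) by (auto simp: c_def norm_divide)
  have S: "bounded_op E ip S" unfolding S_def by (rule bounded_op_scale[OF T])
  have half: "cnorm ip (S x) \<le> cnorm ip x / 2" if "x \<in> E" for x
    unfolding S_def by (rule C(2)[OF c(2) that])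
  \<comment> \<open>The ratio is 1/4 and not 1/2 because \<open>dilation_exists\<close> measures
    squared norms.\<close>
  have "summable (\<lambda>n. (1 / 4 :: real) ^ n)" by (simp add: summable_geometric)
  then have w: "(\<lambda>n. (1 / 4 :: real) ^ n) summable_on UNIV" by (rule summable_nonneg_imp_summable_on) simp
  obtain V where M: "closed_subspace E ip (V ` E)" and iso: "lin_iso ip (V ` E) E (inv_into E V)"
    and V: "bounded_op E ip V" and inj: "inj_on V E"
    and V\<psi>: "\<And>x g i. x \<in> E \<Longrightarrow> i \<in> J \<Longrightarrow> \<Phi> (V x) (\<psi> (g, i)) = \<Phi> ((S ^^ g) x) i"
    and V0: "\<And>x j. x \<in> E \<Longrightarrow> j \<notin> \<psi> ` (UNIV \<times> J) \<Longrightarrow> \<Phi> (V x) j = 0"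
    by (rule dilation_exists[of "\<lambda>n. S ^^ n", OF clinear_on_funpow[OF S] funpow_half(1)[OF S half]
        funpow_half(2)[OF S half] w _ \<psi>, of 0]) auto
  have UV: "U (V x) = V (S x)" if "x \<in> E" for x
    by (rule shift_intertwines[where \<psi> = \<psi> and \<sigma> = Suc and A = "\<lambda>n. S ^^ n",
        OF U bounded_op_in[OF S] bounded_op_in[OF V] V\<psi> V0 \<tau> _ that])
      (simp_all add: funpow_swap1)
  have "U y \<in> V ` E" "inv_into E V (U y) = c *\<^sub>C T (inv_into E V y)" if y: "y \<in> V ` E" for y
  proof -
    obtain x where x: "x \<in> E" "y = V x" using y by blast
    have Sx: "S x \<in> E" by (rule bounded_op_in[OF S x(1)])
    show "U y \<in> V ` E" using UV[OF x(1)] Sx x(2) by simp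
    show "inv_into E V (U y) = c *\<^sub>C T (inv_into E V y)"
      using UV[OF x(1)] inv_into_f_f[OF inj x(1)] inv_into_f_f[OF inj Sx] x(2)
      by (simp add: S_def scaleC_fun_def)
  qed
  then show "\<exists>M c J. closed_subspace E ip M \<and> (\<forall>x\<in>M. U x \<in> M) \<and> c \<noteq> 0 \<and>
      lin_iso ip M E J \<and> (\<forall>x\<in>M. J (U x) = c *\<^sub>C T (J x))"
    using M iso c(1) by blast
qed

theorem shift_pair_universal:
  fixes \<psi> :: "(nat \<times> nat) \<times> 'i \<Rightarrow> 'i"
  assumes U1: "acts_as U1 \<tau>1" and U2: "acts_as U2 \<tau>2"
    and comm: "\<And>x. x \<in> E \<Longrightarrow> U1 (U2 x) = U2 (U1 x)"
    and \<psi>: "inj_on \<psi> (UNIV \<times> J)" "\<psi> ` (UNIV \<times> J) \<subseteq> J"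
    and \<tau>1: "\<And>g i. i \<in> J \<Longrightarrow> \<tau>1 (\<psi> (g, i)) = \<psi> ((Suc (fst g), snd g), i)"
      "\<And>j. j \<in> J \<Longrightarrow> \<tau>1 j \<in> \<psi> ` (UNIV \<times> J) \<Longrightarrow> j \<in> \<psi> ` (UNIV \<times> J)"
    and \<tau>2: "\<And>g i. i \<in> J \<Longrightarrow> \<tau>2 (\<psi> (g, i)) = \<psi> ((fst g, Suc (snd g)), i)"
      "\<And>j. j \<in> J \<Longrightarrow> \<tau>2 j \<in> \<psi> ` (UNIV \<times> J) \<Longrightarrow> j \<in> \<psi> ` (UNIV \<times> J)"
  shows "universal_commuting_pair E ip U1 U2"
  unfolding universal_commuting_pair_def
proof (intro conjI allI impI)
  show "commuting_pair E ip U1 U2"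
    unfolding commuting_pair_def using acts_as_bounded[OF U1] acts_as_bounded[OF U2] comm by blast
  fix T1 T2 assume "commuting_pair E ip T1 T2"
  then have T1: "bounded_op E ip T1" and T2: "bounded_op E ip T2"
    and Tcomm: "\<And>x. x \<in> E \<Longrightarrow> T1 (T2 x) = T2 (T1 x)" by (auto simp: commuting_pair_def)
  obtain C1 where C1: "C1 > 0"
    "\<And>c x. cmod c \<le> 1 / C1 \<Longrightarrow> x \<in> E \<Longrightarrow> cnorm ip ((c *\<^sub>C T1) x) \<le> cnorm ip x / 2"
    using scale_to_half[OF T1] by blast
  obtain C2 where C2: "C2 > 0"
    "\<And>c x. cmod c \<le> 1 / C2 \<Longrightarrow> x \<in> E \<Longrightarrow> cnorm ip ((c *\<^sub>C T2) x) \<le> cnorm ip x / 2"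
    using scale_to_half[OF T2] by blast
  define c where "c = complex_of_real (min (1 / C1) (1 / C2))"
  have "min (1 / C1) (1 / C2) > 0" using C1(1) C2(1) by simp
  then have "cmod c = min (1 / C1) (1 / C2)" "c \<noteq> 0" unfolding c_def norm_of_real of_real_eq_0_iff by linarith+
  then have c: "c \<noteq> 0" "cmod c \<le> 1 / C1" "cmod c \<le> 1 / C2" by auto
  define S1 where "S1 = c *\<^sub>C T1"
  define S2 where "S2 = c *\<^sub>C T2"
  have S1: "bounded_op E ip S1" unfolding S1_def by (rule bounded_op_scale[OF T1])
  have S2: "bounded_op E ip S2" unfolding S2_def by (rule bounded_op_scale[OF T2])
  have half1: "cnorm ip (S1 x) \<le> cnorm ip x / 2" if "x \<in> E" for x
    unfolding S1_def by (rule C1(2)[OF c(2) that])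
  have half2: "cnorm ip (S2 x) \<le> cnorm ip x / 2" if "x \<in> E" for x
    unfolding S2_def by (rule C2(2)[OF c(3) that])
  have Scomm: "S2 (S1 x) = S1 (S2 x)" if "x \<in> E" for x
    using that bounded_op_in[OF T1] bounded_op_in[OF T2] Tcomm
      clinear_on_scale[OF bounded_op_clinear[OF T1]] clinear_on_scale[OF bounded_op_clinear[OF T2]]
    by (simp add: S1_def S2_def scaleC_fun_def)
  have S1_pow: "(S1 ^^ n) x \<in> E"
    "(cnorm ip ((S1 ^^ n) x))\<^sup>2 \<le> (1 / 4) ^ n * (cnorm ip x)\<^sup>2" if "x \<in> E" for n x
    by (rule funpow_half[OF S1], rule half1, assumption, rule that)+
  have S2_pow: "(S2 ^^ n) x \<in> E"
    "(cnorm ip ((S2 ^^ n) x))\<^sup>2 \<le> (1 / 4) ^ n * (cnorm ip x)\<^sup>2" if "x \<in> E" for n x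
    by (rule funpow_half[OF S2], rule half2, assumption, rule that)+
  define A where "A g x = (S1 ^^ fst g) ((S2 ^^ snd g) x)" for g x
  \<comment> \<open>Commutativity enters here: advancing the first counter adds a factor
    \<open>S1\<close> to the left of the powers of \<open>S2\<close>, and it must be moved past them
    to act on \<open>x\<close> first.\<close>
  have A1: "A (Suc (fst g), snd g) x = A g (S1 x)" if x: "x \<in> E" for x g
  proof -
    have "(S2 ^^ m) (S1 x) = S1 ((S2 ^^ m) x)" for m
      by (induction m) (simp_all add: Scomm S2_pow(1) x)
    then show ?thesis by (simp add: A_def funpow_swap1)
  qed
  have A2: "A (fst g, Suc (snd g)) x = A g (S2 x)" for x g by (simp add: A_def funpow_swap1)
  define w where "w g = (1 / 4 :: real) ^ fst g * (1 / 4) ^ snd g" for g :: "nat \<times> nat"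
  have "summable (\<lambda>n. (1 / 4 :: real) ^ n)" by (simp add: summable_geometric)
  then have w1: "(\<lambda>n. (1 / 4 :: real) ^ n) summable_on UNIV" by (rule summable_nonneg_imp_summable_on) simp
  then obtain s where s: "((\<lambda>n. (1 / 4 :: real) ^ n) has_sum s) UNIV" by (auto simp: summable_on_def)
  have "w summable_on (UNIV \<times> UNIV)"
  proof (rule summable_on_SigmaI)
    show "((\<lambda>m. w (n, m)) has_sum (1 / 4) ^ n * s) UNIV" for n
      unfolding w_def using has_sum_cmult_right[OF s] by simp
    show "(\<lambda>n. (1 / 4) ^ n * s) summable_on UNIV" by (rule summable_on_cmult_left[OF w1])
  qed (simp add: w_def)
  then have w: "w summable_on UNIV" by simp
  have Aw: "(cnorm ip (A g x))\<^sup>2 \<le> w g * (cnorm ip x)\<^sup>2" if x: "x \<in> E" for g x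
  proof -
    have "(cnorm ip (A g x))\<^sup>2 \<le> (1 / 4) ^ fst g * (cnorm ip ((S2 ^^ snd g) x))\<^sup>2"
      unfolding A_def by (rule S1_pow(2)[OF S2_pow(1)[OF x]])
    also have "\<dots> \<le> (1 / 4) ^ fst g * ((1 / 4) ^ snd g * (cnorm ip x)\<^sup>2)"
      by (intro mult_left_mono S2_pow(2) x) simp
    finally show ?thesis by (simp add: w_def mult.assoc)
  qed
  have AE: "A g x \<in> E" if "x \<in> E" for g x unfolding A_def by (intro S1_pow(1) S2_pow(1) that)
  have Alin: "clinear_on E (A g)" for g
    using clinear_on_funpow[OF S1, of "fst g"] clinear_on_funpow[OF S2, of "snd g"] S2_pow(1)
    by (auto simp: clinear_on_def A_def)
  obtain V where M: "closed_subspace E ip (V ` E)" and iso: "lin_iso ip E (V ` E) V"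
    and V: "bounded_op E ip V"
    and V\<psi>: "\<And>x g i. x \<in> E \<Longrightarrow> i \<in> J \<Longrightarrow> \<Phi> (V x) (\<psi> (g, i)) = \<Phi> (A g x) i"
    and V0: "\<And>x j. x \<in> E \<Longrightarrow> j \<notin> \<psi> ` (UNIV \<times> J) \<Longrightarrow> \<Phi> (V x) j = 0"
    by (rule dilation_exists[of A, OF Alin AE Aw w _ \<psi>, of "(0, 0)"]) (auto simp: w_def A_def)
  have U1V: "U1 (V x) = V (S1 x)" if "x \<in> E" for x
    by (rule shift_intertwines[where \<psi> = \<psi> and \<sigma> = "\<lambda>g. (Suc (fst g), snd g)" and A = A,
        OF U1 bounded_op_in[OF S1] bounded_op_in[OF V] V\<psi> V0 \<tau>1 A1 that])
  have U2V: "U2 (V x) = V (S2 x)" if "x \<in> E" for x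
    by (rule shift_intertwines[where \<psi> = \<psi> and \<sigma> = "\<lambda>g. (fst g, Suc (snd g))" and A = A,
        OF U2 bounded_op_in[OF S2] bounded_op_in[OF V] V\<psi> V0 \<tau>2 A2 that])
  have "V (S1 x) = c *\<^sub>C V (T1 x)" "V (S2 x) = c *\<^sub>C V (T2 x)" if "x \<in> E" for x
    using that bounded_op_in[OF T1] bounded_op_in[OF T2] clinear_on_scale[OF bounded_op_clinear[OF V]]
    by (simp_all add: S1_def S2_def scaleC_fun_def)
  moreover have "U1 y \<in> V ` E" "U2 y \<in> V ` E" if "y \<in> V ` E" for y
    using that U1V U2V bounded_op_in[OF S1] bounded_op_in[OF S2] by auto
  ultimately show "\<exists>c M V. c \<noteq> 0 \<and> closed_subspace E ip M \<and>
      (\<forall>x\<in>M. U1 x \<in> M) \<and> (\<forall>x\<in>M. U2 x \<in> M) \<and> lin_iso ip E M V \<and>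
      (\<forall>x\<in>E. U1 (V x) = c *\<^sub>C V (T1 x)) \<and> (\<forall>x\<in>E. U2 (V x) = c *\<^sub>C V (T2 x))"
    using M iso c(1) U1V U2V by (intro exI[of _ c] exI[of _ "V ` E"] exI[of _ V]) auto
qed

text \<open>The zero pair would embed the whole space into the joint kernel, which is at most
  one-dimensional.\<close>

theorem shift_pair_not_universal:
  assumes U1: "acts_as U1 \<tau>1" and U2: "acts_as U2 \<tau>2"
    and cover: "\<And>j. j \<in> J \<Longrightarrow> j \<noteq> p0 \<Longrightarrow> j \<in> \<tau>1 ` J \<union> \<tau>2 ` J"
    and pq: "p \<in> J" "q \<in> J" "p \<noteq> q"
  shows "\<not> universal_commuting_pair E ip U1 U2"
proof
  assume univ: "universal_commuting_pair E ip U1 U2"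
  have "bounded_op E ip (\<lambda>_. 0)"
    by (rule bounded_opI[of 0]) (auto simp: csubspace_zero[OF csubspace] norm_zero clinear_on_def)
  then have "commuting_pair E ip (\<lambda>_. 0) (\<lambda>_. 0)" by (simp add: commuting_pair_def)
  then have "\<exists>c M V. c \<noteq> 0 \<and> closed_subspace E ip M \<and>
      (\<forall>x\<in>M. U1 x \<in> M) \<and> (\<forall>x\<in>M. U2 x \<in> M) \<and> lin_iso ip E M V \<and>
      (\<forall>x\<in>E. U1 (V x) = c *\<^sub>C V 0) \<and> (\<forall>x\<in>E. U2 (V x) = c *\<^sub>C V 0)"
    by (rule univ[unfolded universal_commuting_pair_def, THEN conjunct2, rule_format])
  then obtain c M V where M: "closed_subspace E ip M" and iso: "lin_iso ip E M V"
    and k: "\<And>x. x \<in> E \<Longrightarrow> U1 (V x) = c *\<^sub>C V 0" "\<And>x. x \<in> E \<Longrightarrow> U2 (V x) = c *\<^sub>C V 0"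
    by metis
  have lin: "clinear_on E V" and inj: "inj_on V E" and VE: "\<And>x. x \<in> E \<Longrightarrow> V x \<in> E"
    using iso M unfolding lin_iso_def closed_subspace_def bij_betw_def by auto
  note V0 = clinear_on_zero[OF lin csubspace]
  \<comment> \<open>The range of \<open>V\<close> lies in both kernels. A position in the image of
    \<open>\<tau>1\<close> or \<open>\<tau>2\<close> carries a coordinate of \<open>U1 (V x)\<close>
    or \<open>U2 (V x)\<close>, hence zero; only \<open>p0\<close> is left.\<close>
  have off: "\<Phi> (V x) j = 0" if x: "x \<in> E" and j: "j \<noteq> p0" for x j
  proof (cases "j \<in> J")
    case True
    then consider i where "i \<in> J" "j = \<tau>1 i" | i where "i \<in> J" "j = \<tau>2 i" using cover j by blast
    then show ?thesis
    proof cases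
      case 1
      then have "\<Phi> (V x) j = \<Phi> (U1 (V x)) i" using U1 VE[OF x] by (simp add: acts_as_def)
      then show ?thesis by (simp add: k(1)[OF x] V0 coord_zero)
    next
      case 2
      then have "\<Phi> (V x) j = \<Phi> (U2 (V x)) i" using U2 VE[OF x] by (simp add: acts_as_def)
      then show ?thesis by (simp add: k(2)[OF x] V0 coord_zero)
    qed
  qed (simp add: coord_outside VE x)
  define a where "a = \<Phi> (V (basis p)) p0"
  define b where "b = \<Phi> (V (basis q)) p0"
  \<comment> \<open>The images of both basis vectors are determined by their coordinate at
    \<open>p0\<close>; cross-multiplying by these coordinates makes the images equal without a
    division.\<close>
  have eq: "b *\<^sub>C basis p = a *\<^sub>C basis q"
  proof (rule inj_onD[OF inj])
    show "V (b *\<^sub>C basis p) = V (a *\<^sub>C basis q)"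
    proof (rule coord_eqI)
      show "\<Phi> (V (b *\<^sub>C basis p)) j = \<Phi> (V (a *\<^sub>C basis q)) j" for j
        using off[OF basis_in[OF pq(1)], of j] off[OF basis_in[OF pq(2)], of j] pq
        by (cases "j = p0") (simp_all add: clinear_on_scale[OF lin] coord_scale VE basis_in a_def b_def)
    qed (simp_all add: VE csubspace_scale[OF csubspace] basis_in pq)
  qed (simp_all add: csubspace_scale[OF csubspace] basis_in pq)
  \<comment> \<open>Coordinate \<open>p\<close> of the relation gives \<open>b = 0\<close>; but then
    \<open>V\<close> sends \<open>basis q\<close> to zero, against injectivity.\<close>
  have "b = 0"
    using arg_cong[OF eq, of "\<lambda>x. \<Phi> x p"] pq by (simp add: coord_scale basis_in coord_basis)
  then have "V (basis q) = V 0"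
    using off[OF basis_in[OF pq(2)]] unfolding b_def V0
    by (intro coord_eqI VE basis_in pq csubspace_zero[OF csubspace]) (metis coord_zero)
  then have "basis q = 0"
    using inj_onD[OF inj _ basis_in[OF pq(2)] csubspace_zero[OF csubspace]] by blast
  then show False using coord_basis[OF pq(2), of q] by (simp add: coord_zero)
qed

end

section \<open>Multiplication by shifts\<close>

context inner_coords
begin

lemma Lmult_HS:
  assumes U: "bounded_op K ip U" and S: "S \<in> HS K ip" shows "Lmult K U S \<in> HS K ip"
proof -
  have Sb: "bounded_op K ip S" using S by (simp add: HS_iff)
  obtain C where C: "C > 0" "\<And>x. x \<in> K \<Longrightarrow> cnorm ip (U x) \<le> C * cnorm ip x"
    by (rule bounded_opE[OF U]) blast
  have b: "bounded_op K ip (Lmult K U S)"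
    by (rule bounded_op_cong[OF bounded_op_compose[OF U Sb]]) (simp add: Lmult_def)
  have "(\<lambda>j. C\<^sup>2 * (cnorm ip (S (basis j)))\<^sup>2) summable_on J"
    using S by (intro summable_on_cmult_right) (simp add: HS_iff)
  then have "(\<lambda>j. (cnorm ip (Lmult K U S (basis j)))\<^sup>2) summable_on J"
  proof (rule summable_on_real_comparison)
    fix j assume j: "j \<in> J"
    have Sj: "S (basis j) \<in> K" by (rule bounded_op_in[OF Sb basis_in[OF j]])
    have "(cnorm ip (U (S (basis j))))\<^sup>2 \<le> (C * cnorm ip (S (basis j)))\<^sup>2"
      by (intro power_mono C(2) norm_nonneg bounded_op_in[OF U] Sj)
    then show "(cnorm ip (Lmult K U S (basis j)))\<^sup>2 \<le> C\<^sup>2 * (cnorm ip (S (basis j)))\<^sup>2"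
      by (simp add: Lmult_def basis_in j power_mult_distrib)
  qed simp
  then show ?thesis using b by (simp add: HS_iff) (simp add: Lmult_def)
qed

text \<open>Applying \<open>U\<close> after \<open>S\<close> changes each column as a vector, so
  only the row index moves.\<close>

lemma Lmult_acts_as:
  assumes U: "acts_as U \<sigma>"
  shows "l2_coords.acts_as (HS K ip) (J \<times> J) mat (Lmult K U) (\<lambda>(j, k). (\<sigma> j, k))"
proof -
  interpret HS: l2_coords "HS K ip" "HS_ip K ip" "J \<times> J" mat by (rule HS_l2_coords)
  have "mat (Lmult K U S) (j, k) = mat S (\<sigma> j, k)" if "S \<in> HS K ip" "j \<in> J" "k \<in> J" for S j k
  proof -
    have "S (basis k) \<in> K" using that bounded_op_in[OF _ basis_in] by (simp add: HS_iff)
    then show ?thesis using U that by (simp add: mat_def Lmult_def basis_in acts_as_def)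
  qed
  then show ?thesis
    using U Lmult_HS[OF acts_as_bounded[OF U]] unfolding HS.acts_as_def acts_as_def
    by (auto simp: inj_on_def)
qed

text \<open>Column \<open>k\<close> of \<open>S\<close> composed with \<open>U\<close> is column
  \<open>\<sigma> k\<close> of \<open>S\<close>, because \<open>U\<close> sends basis vectors to
  basis vectors. So a forward shift on the right has, on matrices, the effect of a backward shift of
  columns.\<close>

lemma Rmult_acts_as:
  assumes U: "bounded_op K ip U" and \<sigma>: "inj_on \<sigma> J" "\<sigma> ` J \<subseteq> J"
    and basis: "\<And>k. k \<in> J \<Longrightarrow> U (basis k) = basis (\<sigma> k)"
  shows "l2_coords.acts_as (HS K ip) (J \<times> J) mat (Rmult K U) (\<lambda>(j, k). (j, \<sigma> k))"
proof -
  interpret HS: l2_coords "HS K ip" "HS_ip K ip" "J \<times> J" mat by (rule HS_l2_coords)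
  have \<sigma>J: "\<sigma> k \<in> J" if "k \<in> J" for k using \<sigma>(2) that by blast
  have "Rmult K U S \<in> HS K ip" if S: "S \<in> HS K ip" for S
  proof -
    have Sb: "bounded_op K ip S" using S by (simp add: HS_iff)
    have b: "bounded_op K ip (Rmult K U S)"
      by (rule bounded_op_cong[OF bounded_op_compose[OF Sb U]]) (simp add: Rmult_def)
    have "(\<lambda>j. (cnorm ip (S (basis j)))\<^sup>2) summable_on (\<sigma> ` J)"
      by (rule summable_on_subset[OF _ \<sigma>(2)]) (use S in \<open>simp add: HS_iff\<close>)
    then have "((\<lambda>j. (cnorm ip (S (basis j)))\<^sup>2) \<circ> \<sigma>) summable_on J"
      using summable_on_reindex[OF \<sigma>(1)] by blast
    then have "(\<lambda>j. (cnorm ip (Rmult K U S (basis j)))\<^sup>2) summable_on J"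
      by (rule summable_on_cong[THEN iffD1, rotated]) (simp add: Rmult_def basis_in basis)
    then show ?thesis using b by (simp add: HS_iff) (simp add: Rmult_def)
  qed
  moreover have "mat (Rmult K U S) (j, k) = mat S (j, \<sigma> k)" if "k \<in> J" for S j k
    using that by (simp add: mat_def Rmult_def basis_in basis \<sigma>J)
  ultimately show ?thesis
    using \<sigma> unfolding HS.acts_as_def by (auto simp: inj_on_def)
qed

end

section \<open>The shifts on the sequence space and on its Hilbert--Schmidt operators\<close>

lemma Suc_map_inj: "inj_on (\<lambda>(n, h). (Suc n, h)) A"
  by (auto simp: inj_on_def)

text \<open>The two cases of the theorem differ in the size of \<open>I\<close>: a single point for
  \<open>l2\<close>, an infinite basis for the vector-valued space.\<close>

locale ell2_coords = H: inner_coords H ipH I \<phi>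
  for H :: "'h::complex_vector set" and ipH and I :: "'i set" and \<phi>
begin

abbreviation "E \<equiv> HS (ell2 H ipH) (ell2_ip ipH)"
abbreviation "ipE \<equiv> HS_ip (ell2 H ipH) (ell2_ip ipH)"
abbreviation "L \<equiv> Lmult (ell2 H ipH) bshift"
abbreviation "R \<equiv> Rmult (ell2 H ipH) fshift"
abbreviation (input) "suc \<equiv> \<lambda>(n :: nat, h :: 'i). (Suc n, h)"

sublocale K: inner_coords "ell2 H ipH" "ell2_ip ipH" "UNIV \<times> I" "\<lambda>x (n, h). \<phi> (x n) h"
  by (rule ell2_inner_coords) (rule H.inner_coords_axioms)

sublocale E: l2_coords E ipE "(UNIV \<times> I) \<times> (UNIV \<times> I)" K.mat
  by (rule K.HS_l2_coords)

lemma bshift_acts_as: "K.acts_as bshift suc"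
proof -
  have "bshift x \<in> ell2 H ipH" if "x \<in> ell2 H ipH" for x
    using that summable_Suc_iff[of "\<lambda>n. (cnorm ipH (x n))\<^sup>2"] by (simp add: ell2_def bshift_def)
  then show ?thesis unfolding K.acts_as_def by (auto simp: Suc_map_inj bshift_def)
qed

lemma fshift_in: assumes "x \<in> ell2 H ipH" shows "fshift x \<in> ell2 H ipH"
proof -
  have "fshift x n \<in> H" for n
    using assms csubspace_zero[OF H.csubspace] by (simp add: fshift_def ell2_def split: nat.split)
  moreover have "summable (\<lambda>n. (cnorm ipH (fshift x (Suc n)))\<^sup>2)"
    using assms by (simp add: fshift_def ell2_def)
  ultimately show ?thesis
    using summable_Suc_iff[of "\<lambda>n. (cnorm ipH (fshift x n))\<^sup>2"] by (simp add: ell2_def)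
qed

lemma fshift_bounded: "bounded_op (ell2 H ipH) (ell2_ip ipH) fshift"
proof (rule K.bounded_opI[of 1, OF _ fshift_in])
  show "clinear_on (ell2 H ipH) (fshift :: (nat \<Rightarrow> 'h) \<Rightarrow> _)"
    by (auto simp: clinear_on_def fshift_def scaleC_fun_def fun_eq_iff split: nat.split)
  fix x assume x: "x \<in> ell2 H ipH"
  let ?g = "\<lambda>i. (cmod (case i of (n, h) \<Rightarrow> \<phi> (fshift x n) h))\<^sup>2"
  have "((?g \<circ> suc) has_sum (cnorm (ell2_ip ipH) x)\<^sup>2) (UNIV \<times> I)"
    using K.norm_has_sum[OF x] by (rule has_sum_cong[THEN iffD1, rotated]) (auto simp: fshift_def)
  then have "(?g has_sum (cnorm (ell2_ip ipH) x)\<^sup>2) (suc ` (UNIV \<times> I))"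
    using has_sum_reindex[OF Suc_map_inj] by blast
  then have "(?g has_sum (cnorm (ell2_ip ipH) x)\<^sup>2) (UNIV \<times> I)"
  proof (rule has_sum_cong_neutral[THEN iffD1, rotated -1])
    \<comment> \<open>Positions missed by the index shift have \<open>n = 0\<close>, where the
      forward shift inserts a zero; hence it is isometric.\<close>
    fix i assume "i \<in> UNIV \<times> I - suc ` (UNIV \<times> I)"
    then obtain n h where i: "i = (n, h)" "h \<in> I" "(n, h) \<notin> suc ` (UNIV \<times> I)" by auto
    then have "n = 0" by (cases n) auto
    then show "?g i = 0" by (simp add: i fshift_def H.coord_zero)
  qed auto
  from has_sum_unique[OF K.norm_has_sum[OF fshift_in[OF x]] this]
  show "(cnorm (ell2_ip ipH) (fshift x))\<^sup>2 \<le> 1 * (cnorm (ell2_ip ipH) x)\<^sup>2" by simp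
qed auto

lemma fshift_basis:
  assumes "k \<in> UNIV \<times> I" shows "fshift (K.basis k) = K.basis (suc k)"
proof (rule K.coord_eqI[OF fshift_in[OF K.basis_in[OF assms]]])
  obtain m h where k: "k = (m, h)" "h \<in> I" using assms by auto
  show "K.basis (suc k) \<in> ell2 H ipH" by (rule K.basis_in) (simp add: k)
  fix i :: "nat \<times> 'i"
  obtain n h' where i: "i = (n, h')" by (cases i)
  have kJ: "(m, h) \<in> UNIV \<times> I" "(Suc m, h) \<in> UNIV \<times> I" using k by auto
  \<comment> \<open>For \<open>n = 0\<close> both sides vanish, so the truncated
    \<open>n - 1\<close> counts only for successors.\<close>
  show "(case i of (n, h) \<Rightarrow> \<phi> (fshift (K.basis k) n) h) = (case i of (n, h) \<Rightarrow> \<phi> (K.basis (suc k) n) h)"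
    using K.coord_basis[OF kJ(1), of "(n - 1, h')"] K.coord_basis[OF kJ(2), of "(n, h')"]
    by (cases n) (auto simp: i k fshift_def H.coord_zero)
qed

lemma L_acts_as: "E.acts_as L (\<lambda>(j, k). (suc j, k))"
  by (rule K.Lmult_acts_as[OF bshift_acts_as])

lemma R_acts_as: "E.acts_as R (\<lambda>(j, k). (j, suc k))"
  by (rule K.Rmult_acts_as[OF fshift_bounded Suc_map_inj _ fshift_basis]) auto

text \<open>Both sides are \<open>bshift\<close> after \<open>S\<close> after \<open>fshift\<close>;
  the guard in \<open>Lmult\<close> is met because \<open>fshift\<close> preserves the
  space.\<close>

lemma L_R_commute: "L (R S) = R (L S)"
  unfolding Lmult_def Rmult_def using fshift_in by (auto simp: fun_eq_iff)

text \<open>The factor \<open>nat\<close> makes the index set infinite, so its square embeds into it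
  even when \<open>I\<close> is a single point.\<close>

lemma index_inj_exists:
  assumes "I \<noteq> {}"
  obtains r :: "(nat \<times> 'i) \<times> (nat \<times> 'i) \<Rightarrow> nat \<times> 'i"
  where "inj_on r ((UNIV \<times> I) \<times> (UNIV \<times> I))" "r ` ((UNIV \<times> I) \<times> (UNIV \<times> I)) \<subseteq> UNIV \<times> I"
proof -
  have "infinite ((UNIV :: nat set) \<times> I)" using assms by (simp add: finite_cartesian_product_iff)
  then have "(card_of (((UNIV :: nat set) \<times> I) \<times> ((UNIV :: nat set) \<times> I)), card_of ((UNIV :: nat set) \<times> I)) \<in> ordLeq"
    by (rule ordIso_imp_ordLeq[OF card_of_Times_same_infinite])
  then show thesis using that unfolding card_of_ordLeq[symmetric] by blast
qed

lemma L_universal: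
  assumes I: "I \<noteq> {}" shows "universal_op E ipE L"
proof -
  obtain r :: "(nat \<times> 'i) \<times> (nat \<times> 'i) \<Rightarrow> nat \<times> 'i"
    where r: "inj_on r ((UNIV \<times> I) \<times> (UNIV \<times> I))" "r ` ((UNIV \<times> I) \<times> (UNIV \<times> I)) \<subseteq> UNIV \<times> I"
    using index_inj_exists[OF I] .
  obtain h0 where h0: "h0 \<in> I" using I by blast
  show ?thesis
  \<comment> \<open>The row number counts the powers, with \<open>h0\<close> fixed; the column
    index, not moved by \<open>L\<close>, encodes the full position \<open>x\<close> of a matrix
    entry through \<open>r\<close>.\<close>
  proof (rule E.shift_universal[OF L_acts_as, of "\<lambda>(n, x). ((n, h0), r x)"])
    show "inj_on (\<lambda>(n, x). ((n, h0), r x)) (UNIV \<times> ((UNIV \<times> I) \<times> (UNIV \<times> I)))"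
      using r(1) by (auto simp: inj_on_def)
    show "(\<lambda>(n, x). ((n, h0), r x)) ` (UNIV \<times> ((UNIV \<times> I) \<times> (UNIV \<times> I))) \<subseteq> (UNIV \<times> I) \<times> (UNIV \<times> I)"
      using r(2) h0 by auto
  qed (auto simp: image_iff split: prod.splits)
qed

lemma R_universal:
  assumes I: "I \<noteq> {}" shows "universal_op E ipE R"
proof -
  obtain r :: "(nat \<times> 'i) \<times> (nat \<times> 'i) \<Rightarrow> nat \<times> 'i"
    where r: "inj_on r ((UNIV \<times> I) \<times> (UNIV \<times> I))" "r ` ((UNIV \<times> I) \<times> (UNIV \<times> I)) \<subseteq> UNIV \<times> I"
    using index_inj_exists[OF I] .
  obtain h0 where h0: "h0 \<in> I" using I by blast
  show ?thesis
  \<comment> \<open>Columns now count and rows encode.\<close>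
  proof (rule E.shift_universal[OF R_acts_as, of "\<lambda>(n, x). (r x, (n, h0))"])
    show "inj_on (\<lambda>(n, x). (r x, (n, h0))) (UNIV \<times> ((UNIV \<times> I) \<times> (UNIV \<times> I)))"
      using r(1) by (auto simp: inj_on_def)
    show "(\<lambda>(n, x). (r x, (n, h0))) ` (UNIV \<times> ((UNIV \<times> I) \<times> (UNIV \<times> I))) \<subseteq> (UNIV \<times> I) \<times> (UNIV \<times> I)"
      using r(2) h0 by auto
  qed (auto simp: image_iff split: prod.splits)
qed

text \<open>Rows and columns both spend their number as a counter, so a matrix position
  \<open>(x, y)\<close> has to be encoded in the \<open>I\<close> components alone; for infinite
  \<open>I\<close> this works since \<open>nat \<times> I\<close> embeds into
  \<open>I\<close>.\<close>

lemma pair_universal: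
  assumes I: "infinite I" shows "universal_commuting_pair E ipE L R"
proof -
  have "(card_of ((UNIV :: nat set) \<times> I), card_of I) \<in> ordLeq"
    using card_of_Times_infinite[OF I _ infinite_iff_card_of_nat[THEN iffD1, OF I]]
    by (intro ordIso_imp_ordLeq) simp
  then obtain t :: "nat \<times> 'i \<Rightarrow> 'i" where t: "inj_on t (UNIV \<times> I)" "t ` (UNIV \<times> I) \<subseteq> I"
    unfolding card_of_ordLeq[symmetric] by blast
  let ?\<psi> = "\<lambda>((n, m), (x, y)). ((n, t x), (m, t y))"
  show ?thesis
  proof (rule E.shift_pair_universal[OF L_acts_as R_acts_as _, of ?\<psi>])
    show "inj_on ?\<psi> (UNIV \<times> ((UNIV \<times> I) \<times> (UNIV \<times> I)))"
      using t(1) by (auto simp: inj_on_def)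
    show "?\<psi> ` (UNIV \<times> ((UNIV \<times> I) \<times> (UNIV \<times> I))) \<subseteq> (UNIV \<times> I) \<times> (UNIV \<times> I)"
      using t(2) by auto
  qed (auto simp: L_R_commute image_iff split: prod.splits)
qed

text \<open>When \<open>I\<close> has one point, the corner is the only position outside the images
  of both index shifts. A second position, here \<open>((1, h), (0, h))\<close>, shows that the
  whole space is too large for the joint kernel.\<close>

lemma pair_not_universal:
  assumes I: "I = {h}" shows "\<not> universal_commuting_pair E ipE L R"
proof (rule E.shift_pair_not_universal[OF L_acts_as R_acts_as, of "((0, h), (0, h))"
    "((0, h), (0, h))" "((1, h), (0, h))"])
  fix j :: "(nat \<times> 'i) \<times> (nat \<times> 'i)"
  assume "j \<in> (UNIV \<times> I) \<times> (UNIV \<times> I)" "j \<noteq> ((0, h), (0, h))"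
  then obtain n m where j: "j = ((n, h), (m, h))" "n \<noteq> 0 \<or> m \<noteq> 0" unfolding I by blast
  then consider n' where "n = Suc n'" | m' where "m = Suc m'" by (metis nat.exhaust)
  then show "j \<in> (\<lambda>(j, k). (suc j, k)) ` ((UNIV \<times> I) \<times> (UNIV \<times> I)) \<union>
      (\<lambda>(j, k). (j, suc k)) ` ((UNIV \<times> I) \<times> (UNIV \<times> I))"
  proof cases
    case 1
    then have "j = (\<lambda>(j, k). (suc j, k)) ((n', h), (m, h))" by (simp add: j)
    then show ?thesis unfolding I by blast
  next
    case 2
    then have "j = (\<lambda>(j, k). (j, suc k)) ((n, h), (m', h))" by (simp add: j)
    then show ?thesis unfolding I by blast
  qed
qed (simp_all add: I)

end

theorem theorem4p3:
  fixes Hs :: "'h::complex_vector set" and ipH :: "'h \<Rightarrow> 'h \<Rightarrow> complex"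
  assumes "hilbert_space Hs ipH" and "separable_on Hs ipH" and "infinite_dim Hs"
  shows "universal_op (HS l2 l2_ip) (HS_ip l2 l2_ip) (Lmult l2 bshift)
       \<and> universal_op (HS l2 l2_ip) (HS_ip l2 l2_ip) (Rmult l2 fshift)
       \<and> universal_op (HS (ell2 Hs ipH) (ell2_ip ipH)) (HS_ip (ell2 Hs ipH) (ell2_ip ipH))
           (Lmult (ell2 Hs ipH) bshift)
       \<and> universal_op (HS (ell2 Hs ipH) (ell2_ip ipH)) (HS_ip (ell2 Hs ipH) (ell2_ip ipH))
           (Rmult (ell2 Hs ipH) fshift)
       \<and> \<not> universal_commuting_pair (HS l2 l2_ip) (HS_ip l2 l2_ip)
           (Lmult l2 bshift) (Rmult l2 fshift)
       \<and> universal_commuting_pair (HS (ell2 Hs ipH) (ell2_ip ipH)) (HS_ip (ell2 Hs ipH) (ell2_ip ipH))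
           (Lmult (ell2 Hs ipH) bshift) (Rmult (ell2 Hs ipH) fshift)"
proof -
  interpret C: ell2_coords "UNIV :: complex set" ip_C "{()}" "\<lambda>x _. x"
    unfolding ell2_coords_def by (rule complex_inner_coords)
  have "inner_product_space Hs ipH" using assms(1) by (simp add: hilbert_space_def)
  note onb = onb_some_onb[OF this]
  interpret H: ell2_coords Hs ipH "some_onb Hs ipH" "\<lambda>x e. if e \<in> some_onb Hs ipH then ipH x e else 0"
    unfolding ell2_coords_def by (rule onb_inner_coords[OF assms(1) onb])
  have inf: "infinite (some_onb Hs ipH)" by (rule infinite_dim_onb[OF assms(1,3) onb])
  then have ne: "some_onb Hs ipH \<noteq> {}" by auto
  show ?thesis
    unfolding l2_def l2_ip_def
    by (intro conjI C.L_universal C.R_universal H.L_universal[OF ne] H.R_universal[OF ne]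
        C.pair_not_universal H.pair_universal[OF inf]) simp_all
qed

end
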